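(* Let $n\ge 1$, $k\ge 1$ and $\omega\in A_n$. The Primed-Recording Edelman–Greene map $v\mapsto (P(v),Q(v))$ is a bijection from $RSIF_k(\omega)$ onto the set of pairs $(P,Q)$ where $P$ is an Edelman–Greene tableau for $\omega$ and $Q$ is a primed tableau (over the alphabet $\{1'<1<\dots<k'<k\}$) of the same shape as $P$. Moreover it preserves double weight: $(dw(v,1),dw(v,2))=(dw(Q,1),dw(Q,2))$.
   Context: Let $W$ be the group generated by $s_{-n},\dots,s_{-1},s_0,s_1,\dots,s_n$ subject to $(s_as_b)^{m_{ab}}=1$, where $m_{ab}=1$ if $|a|=|b|$; $m_{ab}=3$ if $a,b\ne 0$ and $\bigl||a|-|b|\bigr|=1$; $m_{ab}=4$ if one of $a,b$ is $0$ and $\bigl||a|-|b|\bigr|=1$; $m_{ab}=2$ if $\bigl||a|-|b|\bigr|>1$ (so $s_{-a}=s_a$ and $W$ is the hyperoctahedral group $C_{n+1}$). $A_n\subseteq W$ is the subgroup generated by $s_1,\dots,s_n$ (the symmetric group $S_{n+1}$). A reduced word for $\omega\in W$ is an expression for $\omega$ in the generators $s_{-n},\dots,s_n$ of minimal length. A reduced signed increasing factorization of $\omega$ into $k$ parts is a reduced word for $\omega$ together with a division of it into $k$ consecutive (possibly empty) blocks, each strictly increasing for the order $s_{-n}<\dots<s_{-1}<s_0<s_1<\dots<s_n$; $RSIF_k(\omega)$ denotes the set of these. Its double weight $(dw(v,1),dw(v,2))\in\mathbb Z_{\ge0}^k\times\mathbb Z_{\ge0}^k$ has $i$-th entries equal,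 respectively, to the number of generators with negative index and the number with nonnegative index in the $i$-th block. For $\omega\in A_n$, an Edelman–Greene tableau for $\omega$ is a filling of a Young diagram (English convention) with elements of $\{s_1,\dots,s_n\}$, rows and columns strictly increasing for $s_1<\dots<s_n$, whose reading word (rows read left to right, from the bottom row to the top row) is a reduced word for $\omega$. A primed tableau of shape $\lambda/\mu$ over $X'_k=\{1'<1<2'<2<\dots<k'<k\}$ is a filling of the skew diagram $\lambda/\mu$ with letters of $X'_k$ such that rows and columns weakly increase, each row contains at most one $i'$ and each column at most one $i$, for every $i$. Its double weight is $(X,Y)$ with $X(i)$ = number of entries $i'$ and $Y(i)$ = number of entries $i$. Primed-Recording Edelman–Greene map: for $v\in RSIF_k(\omega)$, let $|v|$ be the word obtained by forgetting the blocks and replacing each $s_{-i}$ by $s_i$. $P(v)$ is the Edelman–Greene insertion tableau of $|v|$ (Edelman–Greene 1987). $Q(v)$ has the same shape: if inserting the $r$-th letter of $|v|$ adds the box $(a,b)$ to the insertion tableau, the box $(a,b)$ of $Q(v)$ is filled with $l'$ if the $r$-th letter of $v$ has negative index and with $l$ otherwise, where $l$ is the index of the block of $v$ containing that letter. *)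

theory Defs
  imports Main
begin

section \<open>The hyperoctahedral group C_{n+1} realised as signed permutations\<close>

text \<open>Elements of W are realised concretely as signed permutations of the integers
(acting on +-1, ..., +-(n+1), fixing everything else).  The generator s_a (a in [-n,n])
is: for a \<noteq> 0 with i = |a|, the map swapping i and i+1 and swapping -i and -(i+1);
for a = 0, the map swapping 1 and -1.  In particular s_{-a} = s_a.\<close>

definition gen :: "int \<Rightarrow> int \<Rightarrow> int" where
  "gen a x =
     (if a = 0 then (if x = 1 then -1 else if x = -1 then 1 else x)
      else (let i = \<bar>a\<bar> in
              if x = i then i + 1 else if x = i + 1 then i
              else if x = -i then -(i + 1) else if x = -(i + 1) then -i else x))"

definition word_eval :: "int list \<Rightarrow> int \<Rightarrow> int" where
  "word_eval w = foldr (\<lambda>a f. gen a \<circ> f) w id"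

definition gen_words :: "nat \<Rightarrow> int list set" where
  "gen_words n = lists {-int n..int n}"

definition A_grp :: "nat \<Rightarrow> (int \<Rightarrow> int) set" where
  "A_grp n = word_eval ` lists {1..int n}"

definition W_length :: "nat \<Rightarrow> (int \<Rightarrow> int) \<Rightarrow> nat" where
  "W_length n \<omega> = (LEAST m. \<exists>u \<in> gen_words n. length u = m \<and> word_eval u = \<omega>)"

definition reduced_word :: "nat \<Rightarrow> (int \<Rightarrow> int) \<Rightarrow> int list \<Rightarrow> bool" where
  "reduced_word n \<omega> v \<longleftrightarrow>
     v \<in> gen_words n \<and> word_eval v = \<omega> \<and> length v = W_length n \<omega>"

definition RSIF :: "nat \<Rightarrow> nat \<Rightarrow> (int \<Rightarrow> int) \<Rightarrow> int list list set" where
  "RSIF n k \<omega> = {v. length v = k \<and> (\<forall>blk \<in> set v. sorted_wrt (<) blk)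
                     \<and> reduced_word n \<omega> (concat v)}"

definition dw_fact :: "int list list \<Rightarrow> nat list \<times> nat list" where
  "dw_fact v = (map (\<lambda>blk. length (filter (\<lambda>a. a < 0) blk)) v,
                map (\<lambda>blk. length (filter (\<lambda>a. 0 \<le> a) blk)) v)"

section \<open>Tableaux (English convention, list of rows, top row first)\<close>

definition young_shape :: "'a list list \<Rightarrow> bool" where
  "young_shape T \<longleftrightarrow> (\<forall>r \<in> set T. r \<noteq> []) \<and>
     (\<forall>a. a + 1 < length T \<longrightarrow> length (T ! (a + 1)) \<le> length (T ! a))"

definition col :: "'a list list \<Rightarrow> nat \<Rightarrow> 'a list" where
  "col T b = map (\<lambda>r. r ! b) (filter (\<lambda>r. b < length r) T)"

definition reading_word :: "'a list list \<Rightarrow> 'a list" where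
  "reading_word T = concat (rev T)"

definition EG_tableau :: "nat \<Rightarrow> (int \<Rightarrow> int) \<Rightarrow> nat list list \<Rightarrow> bool" where
  "EG_tableau n \<omega> P \<longleftrightarrow> young_shape P \<and>
     (\<forall>r \<in> set P. \<forall>x \<in> set r. 1 \<le> x \<and> x \<le> n) \<and>
     (\<forall>r \<in> set P. sorted_wrt (<) r) \<and>
     (\<forall>b. sorted_wrt (<) (col P b)) \<and>
     reduced_word n \<omega> (map int (reading_word P))"

datatype primed = Primed nat | Unprimed nat

fun prank :: "primed \<Rightarrow> nat" where
  "prank (Primed i) = 2 * i - 1"
| "prank (Unprimed i) = 2 * i"

fun in_alphabet :: "nat \<Rightarrow> primed \<Rightarrow> bool" where
  "in_alphabet k (Primed i) \<longleftrightarrow> 1 \<le> i \<and> i \<le> k"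
| "in_alphabet k (Unprimed i) \<longleftrightarrow> 1 \<le> i \<and> i \<le> k"

definition primed_tableau :: "nat \<Rightarrow> primed list list \<Rightarrow> bool" where
  "primed_tableau k Q \<longleftrightarrow> young_shape Q \<and>
     (\<forall>r \<in> set Q. \<forall>x \<in> set r. in_alphabet k x) \<and>
     (\<forall>r \<in> set Q. sorted (map prank r)) \<and>
     (\<forall>b. sorted (map prank (col Q b))) \<and>
     (\<forall>r \<in> set Q. \<forall>i. count_list r (Primed i) \<le> 1) \<and>
     (\<forall>b i. count_list (col Q b) (Unprimed i) \<le> 1)"

definition dw_tab :: "nat \<Rightarrow> primed list list \<Rightarrow> nat list \<times> nat list" where
  "dw_tab k Q = (map (\<lambda>i. count_list (concat Q) (Primed i)) [1..<k+1],
                 map (\<lambda>i. count_list (concat Q) (Unprimed i)) [1..<k+1])"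

fun replace_first_gt :: "nat \<Rightarrow> nat list \<Rightarrow> nat list" where
  "replace_first_gt x [] = []"
| "replace_first_gt x (y # ys) = (if x < y then x # ys else y # replace_first_gt x ys)"

fun eg_ins :: "nat \<Rightarrow> nat list list \<Rightarrow> nat list list \<times> (nat \<times> nat)" where
  "eg_ins x [] = ([[x]], (0, 0))"
| "eg_ins x (r # rs) =
     (case find (\<lambda>y. x < y) r of
        None \<Rightarrow> ((r @ [x]) # rs, (0, length r))
      | Some y \<Rightarrow>
          (let (T', (a, b)) = eg_ins y rs
           in (if y = x + 1 \<and> x \<in> set r then r # T' else replace_first_gt x r # T',
               (a + 1, b))))"

text \<open>Fill box (a, _) of the recording tableau: since insertion adds a box at the end of
row a (possibly a new row), the new entry is appended to row a.\<close>
definition add_cell :: "nat \<Rightarrow> 'b \<Rightarrow> 'b list list \<Rightarrow> 'b list list" where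
  "add_cell a l Q = (if a < length Q then Q[a := Q ! a @ [l]] else Q @ [[l]])"

definition pr_step :: "nat list list \<times> primed list list \<Rightarrow> nat \<times> primed
                         \<Rightarrow> nat list list \<times> primed list list" where
  "pr_step PQ xl = (case PQ of (P, Q) \<Rightarrow> case xl of (x, l) \<Rightarrow>
      (case eg_ins x P of (P', (a, b)) \<Rightarrow> (P', add_cell a l Q)))"

definition labelled_letters :: "int list list \<Rightarrow> (nat \<times> primed) list" where
  "labelled_letters v =
     concat (map (\<lambda>(l, blk). map (\<lambda>a. (nat \<bar>a\<bar>, if a < 0 then Primed l else Unprimed l)) blk)
                 (zip [1..<length v + 1] v))"

definition PREG :: "int list list \<Rightarrow> nat list list \<times> primed list list" where
  "PREG v = foldl pr_step ([], []) (labelled_letters v)"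

end

(* The absolute values of one block first decrease (negative letters) and then increase
   (nonnegative letters), so a factorization is a reduced word whose letters carry weakly increasing
   labels 1' < 1 < 2' < ..., decreasing in value along each l' and increasing along each l.
   Edelman-Greene insertion is invertible at every corner and turns ascents (descents) of the word
   into steps weakly up (strictly down) of the new box.  So the boxes labelled l' form a vertical
   strip filled downwards and those labelled l a horizontal strip filled upwards; hence the box added
   last can be read off the primed tableau, and the word is recovered by reverse insertion.
   A reduced word of an element of A_n has no letter 0, because the projection of W onto the
   symmetric group lets one delete the letters 0. *)

theory Submission
  imports Defs
begin

section \<open>Reduced words\<close>

text \<open>\<open>eg_ins\<close> is total, but on arbitrary words it can destroy the strict rows
  and columns, so everything hinges on reducedness. It is used as plain minimality of length, and
  inside insertion mostly through one obstruction: commutations and braid moves may never bring two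
  equal letters together. This forces \<open>y = Suc x\<close> when the inserted letter already
  stands in the row, and makes consecutive letters differ. Insertion is treated as a relation
  \<open>ins\<close> that is read in both directions; existence and uniqueness of its backward
  reading play the part of an inverse function. Boxes appear only at row ends, so the row index
  alone locates them.\<close>

lemma word_eval_Nil [simp]: "word_eval [] = id"
  by (simp add: word_eval_def)

lemma word_eval_Cons [simp]: "word_eval (a # w) = gen a \<circ> word_eval w"
  by (simp add: word_eval_def)

lemma word_eval_append [simp]: "word_eval (u @ v) = word_eval u \<circ> word_eval v"
  by (induction u) (simp_all add: comp_assoc)

lemma gen_uminus: "gen (- a) = gen a"
  by (auto simp: gen_def fun_eq_iff)

lemma gen_abs: "gen \<bar>a\<bar> = gen a"
  by (simp add: abs_if gen_uminus)

lemma word_eval_abs: "word_eval (map abs w) = word_eval w"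
  by (induction w) (simp_all add: gen_abs)

lemma gen_pos:
  assumes "0 < a"
  shows "gen a x = (if x = a then a + 1 else if x = a + 1 then a
    else if x = - a then - a - 1 else if x = - a - 1 then - a else x)"
  using assms by (simp add: gen_def)

lemma gen_involution: "gen a (gen a x) = x"
proof -
  have "gen a (gen a x) = x" if "0 < a" for a
    using that by (simp add: gen_pos)
  moreover have "gen 0 (gen 0 x) = x" by (simp add: gen_def)
  ultimately show ?thesis
    by (metis gen_abs abs_of_pos zero_less_abs_iff)
qed

lemma gen_odd: "gen a (- x) = - gen a x"
proof -
  have "gen a (- x) = - gen a x" if "0 < a" for a
    using that by (auto simp: gen_pos)
  moreover have "gen 0 (- x) = - gen 0 x" by (auto simp: gen_def)
  ultimately show ?thesis
    by (metis gen_abs zero_less_abs_iff)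
qed

lemma gen_commute:
  assumes "0 < a" "a + 2 \<le> b"
  shows "gen a (gen b x) = gen b (gen a x)"
  using assms by (simp add: gen_pos)

lemma gen_braid:
  assumes "0 < a"
  shows "gen a (gen (a + 1) (gen a x)) = gen (a + 1) (gen a (gen (a + 1) x))"
  using assms by (simp add: gen_pos)

lemma word_eval_odd: "word_eval w (- x) = - word_eval w x"
  by (induction w) (simp_all add: gen_odd)

lemma abs_gen: "\<bar>gen a x\<bar> = (if a = 0 then \<bar>x\<bar> else gen a \<bar>x\<bar>)"
  by (auto simp: gen_def Let_def abs_if)

text \<open>Taking absolute values is the projection of W onto the symmetric group that kills the
  generator with index 0.\<close>

lemma abs_word_eval: "\<bar>word_eval w x\<bar> = word_eval (filter (\<lambda>a. a \<noteq> 0) w) \<bar>x\<bar>"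
  by (induction w) (simp_all add: abs_gen)

text \<open>\<open>abs_word_eval\<close>, applied to \<open>w\<close> and to a word in positive
  letters with the same value, shows that deleting the letters 0 changes nothing on nonnegative
  arguments; oddness settles the negative ones.\<close>

lemma word_eval_filter_nonzero:
  assumes "word_eval w \<in> A_grp n"
  shows "word_eval (filter (\<lambda>a. a \<noteq> 0) w) = word_eval w"
proof
  fix x
  let ?w = "filter (\<lambda>a. a \<noteq> 0) w"
  obtain u where u: "u \<in> lists {1..int n}" "word_eval w = word_eval u"
    using assms by (auto simp: A_grp_def)
  have "filter (\<lambda>a. a \<noteq> 0) u = u"
    using u(1) by (auto simp: filter_id_conv)
  then have *: "word_eval ?w \<bar>y\<bar> = word_eval w \<bar>y\<bar>" for y
    using abs_word_eval[of w y] abs_word_eval[of u y] u(2) by simp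
  show "word_eval ?w x = word_eval w x"
    using *[of x] word_eval_odd[of ?w x] word_eval_odd[of w x] by (cases "x \<ge> 0") auto
qed

lemma reduced_word_iff:
  "reduced_word n \<omega> v \<longleftrightarrow> v \<in> gen_words n \<and> word_eval v = \<omega> \<and>
     (\<forall>u \<in> gen_words n. word_eval u = \<omega> \<longrightarrow> length v \<le> length u)"
proof -
  let ?P = "\<lambda>m. \<exists>u \<in> gen_words n. length u = m \<and> word_eval u = \<omega>"
  have "length v = (LEAST m. ?P m) \<longleftrightarrow> (\<forall>u \<in> gen_words n. word_eval u = \<omega> \<longrightarrow> length v \<le> length u)"
    if "v \<in> gen_words n" "word_eval v = \<omega>"
  proof
    assume "length v = (LEAST m. ?P m)"
    then show "\<forall>u \<in> gen_words n. word_eval u = \<omega> \<longrightarrow> length v \<le> length u"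
      by (auto intro!: Least_le)
  next
    assume "\<forall>u \<in> gen_words n. word_eval u = \<omega> \<longrightarrow> length v \<le> length u"
    then show "length v = (LEAST m. ?P m)"
      using that by (intro Least_equality[symmetric]) auto
  qed
  then show ?thesis
    unfolding reduced_word_def W_length_def by blast
qed

lemma reduced_word_nonzero:
  assumes "reduced_word n \<omega> v" "\<omega> \<in> A_grp n"
  shows "0 \<notin> set v"
proof
  assume "0 \<in> set v"
  then have "length (filter (\<lambda>a. a \<noteq> 0) v) < length v"
    by (simp add: length_filter_less)
  moreover have "filter (\<lambda>a. a \<noteq> 0) v \<in> gen_words n"
    using assms(1) by (auto simp: reduced_word_iff gen_words_def)
  moreover have "word_eval (filter (\<lambda>a. a \<noteq> 0) v) = \<omega>"
    using word_eval_filter_nonzero[of v n] assms by (auto simp: reduced_word_iff)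
  ultimately show False
    using assms(1) by (fastforce simp: reduced_word_iff)
qed

text \<open>The value is that of the word itself, so factors of a reduced word can be treated too.
  The competitors range over \<open>gen_words n\<close>, with 0 and negative letters: minimality is
  meant in W, not in the symmetric group.\<close>

definition red :: "nat \<Rightarrow> nat list \<Rightarrow> bool" where
  "red n w \<longleftrightarrow> set w \<subseteq> {1..n} \<and>
     (\<forall>u \<in> gen_words n. word_eval u = word_eval (map int w) \<longrightarrow> length w \<le> length u)"

text \<open>Stands for equivalence under Coxeter moves. Value, length and letter set are all that
  \<open>red\<close> can see, the letter set because of the bound \<open>{1..n}\<close>.\<close>

definition cox_eq :: "nat list \<Rightarrow> nat list \<Rightarrow> bool" where
  "cox_eq u v \<longleftrightarrow> length u = length v \<and> set u = set v \<and>
     word_eval (map int u) = word_eval (map int v)"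

lemma cox_eq_refl [simp]: "cox_eq u u"
  by (simp add: cox_eq_def)

lemma cox_eq_sym: "cox_eq u v \<Longrightarrow> cox_eq v u"
  by (simp add: cox_eq_def)

lemma cox_eq_trans [trans]: "cox_eq u v \<Longrightarrow> cox_eq v w \<Longrightarrow> cox_eq u w"
  by (simp add: cox_eq_def)

lemma cox_eq_append: "cox_eq u u' \<Longrightarrow> cox_eq v v' \<Longrightarrow> cox_eq (u @ v) (u' @ v')"
  by (simp add: cox_eq_def)

lemma cox_eq_Cons: "cox_eq v v' \<Longrightarrow> cox_eq (x # v) (x # v')"
  by (simp add: cox_eq_def)

lemma red_cox_eq: "cox_eq u v \<Longrightarrow> red n u \<longleftrightarrow> red n v"
  by (simp add: cox_eq_def red_def)

section \<open>Factors of reduced words and Coxeter moves\<close>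

lemma red_factor:
  assumes "red n (u @ v @ w)"
  shows "red n v"
  unfolding red_def
proof (intro conjI ballI impI)
  show "set v \<subseteq> {1..n}" using assms by (simp add: red_def)
next
  fix v' assume v': "v' \<in> gen_words n" "word_eval v' = word_eval (map int v)"
  have "map int u @ v' @ map int w \<in> gen_words n"
    using assms v'(1) by (force simp: red_def gen_words_def)
  moreover have "word_eval (map int u @ v' @ map int w) = word_eval (map int (u @ v @ w))"
    using v'(2) by simp
  ultimately have "length (u @ v @ w) \<le> length (map int u @ v' @ map int w)"
    using assms unfolding red_def by blast
  then show "length v \<le> length v'" by simp
qed

lemma red_prefix: "red n (u @ v) \<Longrightarrow> red n u"
  using red_factor[of n "[]" u v] by simp

lemma red_suffix: "red n (u @ v) \<Longrightarrow> red n v"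
  using red_factor[of n u v "[]"] by simp

lemma red_no_square: "\<not> red n (u @ x # x # w)"
proof
  assume "red n (u @ x # x # w)"
  then have "red n [x, x]" using red_factor[of n u "[x, x]" w] by simp
  moreover have "[] \<in> gen_words n" by (simp add: gen_words_def)
  moreover have "word_eval [] = word_eval (map int [x, x])"
    by (simp add: fun_eq_iff gen_involution)
  ultimately show False unfolding red_def by fastforce
qed

lemma cox_eq_commute:
  assumes "0 < x" "\<And>z. z \<in> set zs \<Longrightarrow> 0 < z \<and> (z + 2 \<le> x \<or> x + 2 \<le> z)"
  shows "cox_eq (x # zs) (zs @ [x])"
  using assms(2)
proof (induction zs)
  case (Cons z zs)
  have "gen (int x) (gen (int z) y) = gen (int z) (gen (int x) y)" for y
  proof (cases "z + 2 \<le> x")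
    case True
    then show ?thesis using gen_commute[of "int z" "int x" y] Cons.prems[of z] by simp
  next
    case False
    then show ?thesis using gen_commute[of "int x" "int z" y] Cons.prems[of z] assms(1) by simp
  qed
  then have "cox_eq (x # z # zs) (z # x # zs)"
    by (auto simp: cox_eq_def fun_eq_iff)
  also have "cox_eq (z # x # zs) (z # zs @ [x])"
    using Cons.prems by (intro cox_eq_Cons Cons.IH) simp
  finally show ?case by simp
qed simp

lemma cox_eq_braid: "0 < x \<Longrightarrow> cox_eq [x, Suc x, x] [Suc x, x, Suc x]"
  using gen_braid[of "int x"] by (auto simp: cox_eq_def fun_eq_iff add.commute)

section \<open>Bumping a letter out of a row\<close>

text \<open>Inserting \<open>x\<close> into the row \<open>r\<close> bumps \<open>y\<close> and leaves \<open>r'\<close>.  As a relation this reads equally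
  well backwards, so the same notion describes reverse insertion.\<close>

definition bump :: "nat list \<Rightarrow> nat \<Rightarrow> nat \<Rightarrow> nat list \<Rightarrow> bool" where
  "bump r x y r' \<longleftrightarrow> sorted_wrt (<) r \<and> sorted_wrt (<) r' \<and> x < y \<and>
     ((\<exists>r1 r2. r = r1 @ y # r2 \<and> r' = r1 @ x # r2) \<or>
      (\<exists>r1 r2. r = r1 @ x # y # r2 \<and> r' = r \<and> y = Suc x))"

lemma bump_cases:
  assumes "bump r x y r'"
  obtains (replace) r1 r2 where "r = r1 @ y # r2" "r' = r1 @ x # r2" "x < y"
      "\<And>z. z \<in> set r1 \<Longrightarrow> z < x" "\<And>z. z \<in> set r2 \<Longrightarrow> y < z"
  | (keep) r1 r2 where "r = r1 @ x # y # r2" "r' = r" "y = Suc x"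
      "\<And>z. z \<in> set r1 \<Longrightarrow> z < x" "\<And>z. z \<in> set r2 \<Longrightarrow> y < z"
  using assms unfolding bump_def by (fastforce simp: sorted_wrt_append)

lemma bump_sorted: "bump r x y r' \<Longrightarrow> sorted_wrt (<) r \<and> sorted_wrt (<) r'"
  by (simp add: bump_def)

lemma bump_length: "bump r x y r' \<Longrightarrow> length r' = length r"
  by (auto simp: bump_def)

text \<open>Everything in \<open>r2\<close> exceeds \<open>x\<close> by at least 2 and everything in
  \<open>r1\<close> is at least 2 below \<open>y\<close>, so \<open>x\<close> travels left over
  \<open>r2\<close> and \<open>y\<close> left over \<open>r1\<close>. When \<open>x\<close> is kept,
  the braid relation is applied in between.\<close>

lemma bump_cox_eq:
  assumes "bump r x y r'" "0 \<notin> set r" "0 < x"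
  shows "cox_eq (r @ [x]) (y # r')"
  using assms(1)
proof (cases rule: bump_cases)
  case (replace r1 r2)
  have pos: "0 < z" if "z \<in> set r" for z
    using that assms(2) by (metis gr0I)
  have "cox_eq (x # r2) (r2 @ [x])"
    using replace pos assms(3) by (intro cox_eq_commute) fastforce+
  then have "cox_eq (r1 @ y # r2 @ [x]) (r1 @ y # x # r2)"
    by (intro cox_eq_append cox_eq_Cons) (auto intro: cox_eq_sym)
  moreover have "cox_eq (y # r1) (r1 @ [y])"
    using replace pos by (intro cox_eq_commute) fastforce+
  then have "cox_eq ((r1 @ [y]) @ x # r2) ((y # r1) @ x # r2)"
    by (intro cox_eq_append) (auto intro: cox_eq_sym)
  ultimately show ?thesis
    using replace by (auto intro: cox_eq_trans)
next
  case (keep r1 r2)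
  have pos: "0 < z" if "z \<in> set r" for z
    using that assms(2) by (metis gr0I)
  have "cox_eq (x # r2) (r2 @ [x])"
    using keep pos assms(3) by (intro cox_eq_commute) fastforce+
  then have "cox_eq (r1 @ [x, y] @ r2 @ [x]) (r1 @ [x, y] @ x # r2)"
    by (intro cox_eq_append) (auto intro: cox_eq_sym)
  also have "cox_eq (r1 @ [x, y, x] @ r2) (r1 @ [y, x, y] @ r2)"
    using cox_eq_braid[OF assms(3)] keep(3) by (intro cox_eq_append) auto
  then have "cox_eq (r1 @ [x, y] @ x # r2) ((r1 @ [y]) @ [x, y] @ r2)"
    by simp
  also have "cox_eq (y # r1) (r1 @ [y])"
    using keep pos by (intro cox_eq_commute) fastforce+
  then have "cox_eq ((r1 @ [y]) @ [x, y] @ r2) ((y # r1) @ [x, y] @ r2)"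
    by (intro cox_eq_append) (auto intro: cox_eq_sym)
  finally show ?thesis
    using keep by simp
qed

section \<open>Agreement with the functional insertion step\<close>

lemma find_first: "find P (r1 @ y # r2) = Some y" if "\<forall>z \<in> set r1. \<not> P z" "P y"
  using that by (induction r1) auto

lemma find_SomeE:
  assumes "find P r = Some y"
  obtains r1 r2 where "r = r1 @ y # r2" "\<forall>z \<in> set r1. \<not> P z" "P y"
  using assms
proof (induction r arbitrary: thesis)
  case (Cons a r)
  show ?case
  proof (cases "P a")
    case True
    then show ?thesis using Cons.prems(1)[of "[]" r] Cons.prems(2) by simp
  next
    case False
    then obtain r1 r2 where "r = r1 @ y # r2" "\<forall>z \<in> set r1. \<not> P z" "P y"
      using Cons by auto
    then show ?thesis using Cons.prems(1)[of "a # r1" r2] False by simp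
  qed
qed simp

lemma replace_first_gt_append:
  "replace_first_gt x (r1 @ y # r2) = r1 @ x # r2" if "\<forall>z \<in> set r1. \<not> x < z" "x < y"
  using that by (induction r1) auto

lemma bump_eg:
  assumes "bump r x y r'"
  shows "find (\<lambda>y. x < y) r = Some y"
    and "(if y = x + 1 \<and> x \<in> set r then r else replace_first_gt x r) = r'"
proof -
  from assms have "find (\<lambda>y. x < y) r = Some y \<and>
    (if y = x + 1 \<and> x \<in> set r then r else replace_first_gt x r) = r'"
  proof (cases rule: bump_cases)
    case (replace r1 r2)
    then have "x \<notin> set r" by fastforce
    with replace show ?thesis
      using find_first[of r1 "\<lambda>y. x < y" y r2] replace_first_gt_append[of r1 x y r2] by fastforce
  next
    case (keep r1 r2)
    then show ?thesis
      using find_first[of "r1 @ [x]" "\<lambda>y. x < y" y r2] by fastforce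
  qed
  then show "find (\<lambda>y. x < y) r = Some y"
    and "(if y = x + 1 \<and> x \<in> set r then r else replace_first_gt x r) = r'" by auto
qed

section \<open>Bumps in reduced words, forwards and backwards\<close>

lemma red_pos: "red n w \<Longrightarrow> 0 \<notin> set w"
  by (auto simp: red_def)

lemma red_posD: "red n w \<Longrightarrow> z \<in> set w \<Longrightarrow> 0 < z"
  by (auto simp: red_def)

text \<open>Reducedness enters when \<open>x\<close> is already in the row. Then \<open>y\<close>
  directly follows it, and if \<open>y\<close> were larger than \<open>Suc x\<close>, the new
  \<open>x\<close> could move left over \<open>y # r2\<close> and stand next to the old one.\<close>

lemma bump_exists:
  assumes "sorted_wrt (<) r" "red n (r @ [x])" "find (\<lambda>y. x < y) r = Some y"
  shows "bump r x y (if y = x + 1 \<and> x \<in> set r then r else replace_first_gt x r)"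
proof -
  obtain r1 r2 where r: "r = r1 @ y # r2" "\<forall>z \<in> set r1. \<not> x < z" "x < y"
    using find_SomeE[OF assms(3)] by metis
  have gt: "y < z" if "z \<in> set r2" for z
    using assms(1) that r(1) by (auto simp: sorted_wrt_append)
  show ?thesis
  proof (cases "x \<in> set r")
    case False
    then have "\<forall>z \<in> set r1. z < x"
      using r by (auto simp: not_less order.strict_iff_order)
    then have "sorted_wrt (<) (r1 @ x # r2)"
      using assms(1) r gt by (fastforce simp: sorted_wrt_append)
    then show ?thesis
      using r assms(1) False by (auto simp: bump_def replace_first_gt_append)
  next
    case True
    then have "x \<in> set r1" using r gt by fastforce
    then obtain r0 r3 where "r1 = r0 @ x # r3" by (meson split_list)
    moreover from this have "r3 = []"
      using assms(1) r(1,2) by (cases r3) (auto simp: sorted_wrt_append)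
    ultimately have r': "r = r0 @ x # y # r2" using r by simp
    have "y = Suc x"
    proof (rule ccontr)
      assume "y \<noteq> Suc x"
      then have "cox_eq (x # y # r2) ((y # r2) @ [x])"
        using r(3) gt red_posD[OF assms(2)] r' by (intro cox_eq_commute) fastforce+
      then have "cox_eq ((r0 @ [x]) @ (y # r2) @ [x]) ((r0 @ [x]) @ x # y # r2)"
        by (intro cox_eq_append) (auto intro: cox_eq_sym)
      then have "red n (r0 @ x # x # y # r2)"
        using assms(2) r' red_cox_eq by simp
      then show False using red_no_square by blast
    qed
    then show ?thesis
      using True assms(1) r' by (auto simp: bump_def)
  qed
qed

text \<open>With no larger entry in the row, a copy of \<open>x\<close> could only be its last
  entry, adjacent to the new letter.\<close>

lemma red_append_greatest:
  assumes "sorted_wrt (<) r" "red n (r @ [x])" "find (\<lambda>y. x < y) r = None" "z \<in> set r"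
  shows "z < x"
proof (rule ccontr)
  have le: "\<forall>z \<in> set r. z \<le> x"
    using assms(3) by (auto simp: find_None_iff)
  assume "\<not> z < x"
  then have "x \<in> set r" using le assms(4) by fastforce
  then obtain r1 r2 where r: "r = r1 @ x # r2" by (meson split_list)
  then have "r2 = []" using assms(1) le by (cases r2) (auto simp: sorted_wrt_append)
  then show False using red_no_square[of n r1 x "[]"] assms(2) r by simp
qed

text \<open>Mirror image of \<open>bump_exists\<close>: the candidate \<open>x\<close> is the last
  entry below \<open>y\<close>. If \<open>y\<close> occurs in the row and is not
  \<open>Suc x\<close>, the leading \<open>y\<close> could move right over \<open>r1 @ [x]\<close>
  and meet its copy.\<close>

lemma bump_reverse_exists:
  assumes "sorted_wrt (<) r'" "red n (y # r')" "\<exists>z \<in> set r'. z < y"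
  obtains r x where "bump r x y r'" "x \<in> set r'"
proof -
  obtain r1 x r2 where r': "r' = r1 @ x # r2" "x < y" "\<forall>z \<in> set r2. \<not> z < y"
    using split_list_last_prop[OF assms(3)] by metis
  have lt: "z < x" if "z \<in> set r1" for z
    using assms(1) that r'(1) by (auto simp: sorted_wrt_append)
  show ?thesis
  proof (cases "y \<in> set r2")
    case False
    then have gt: "\<forall>z \<in> set r2. y < z"
      using r' by (auto simp: not_less order.strict_iff_order)
    then have "sorted_wrt (<) (r1 @ y # r2)"
      using assms(1) r' lt by (fastforce simp: sorted_wrt_append)
    then show ?thesis
      using r' assms(1) by (intro that[of "r1 @ y # r2" x]) (auto simp: bump_def)
  next
    case True
    then obtain s r3 where "r2 = s @ y # r3" by (meson split_list)
    moreover from this have "s = []"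
      using assms(1) r' by (cases s) (auto simp: sorted_wrt_append)
    ultimately have r: "r' = r1 @ x # y # r3" using r' by simp
    have "y = Suc x"
    proof (rule ccontr)
      assume "y \<noteq> Suc x"
      then have "cox_eq (y # (r1 @ [x])) ((r1 @ [x]) @ [y])"
        using r'(2) lt red_posD[OF assms(2)] r by (intro cox_eq_commute) fastforce+
      then have "cox_eq ((y # (r1 @ [x])) @ y # r3) (((r1 @ [x]) @ [y]) @ y # r3)"
        by (intro cox_eq_append) auto
      then have "red n ((r1 @ [x]) @ y # y # r3)"
        using assms(2) r red_cox_eq by simp
      then show False using red_no_square by blast
    qed
    then show ?thesis
      using assms(1) r by (intro that[of r' x]) (auto simp: bump_def)
  qed
qed

text \<open>\<open>r'\<close> and \<open>y\<close> decide everything: \<open>x\<close> was kept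
  exactly if \<open>y\<close> still occurs in \<open>r'\<close>, and in both cases \<open>x\<close>
  is the largest entry of \<open>r'\<close> below \<open>y\<close>.\<close>

lemma bump_inj:
  assumes "bump r x y r'" "bump s z y r'"
  shows "r = s \<and> x = z"
  using assms(1)
proof (cases rule: bump_cases)
  case r: (replace r1 r2)
  from assms(2) show ?thesis
  proof (cases rule: bump_cases)
    case s: (replace s1 s2)
    have "x = z"
    proof (rule ccontr)
      assume "x \<noteq> z"
      have "z \<in> set (r1 @ x # r2)" using r(2) s(2) by (metis in_set_conv_decomp)
      then have "z < x" using \<open>x \<noteq> z\<close> r s(3) by fastforce
      have "x \<in> set (s1 @ z # s2)" using r(2) s(2) by (metis in_set_conv_decomp)
      then have "x < z" using \<open>x \<noteq> z\<close> s r(3) by fastforce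
      then show False using \<open>z < x\<close> by simp
    qed
    moreover have "x \<notin> set r1" "x \<notin> set r2" using r by fastforce+
    ultimately show ?thesis
      using r s append_Cons_eq_iff[of x r1 r2 s1 s2] by auto
  next
    case (keep s1 s2)
    then have "y \<in> set (r1 @ x # r2)" using r(2) by auto
    then show ?thesis using r by fastforce
  qed
next
  case r: (keep r1 r2)
  from assms(2) show ?thesis
  proof (cases rule: bump_cases)
    case (replace s1 s2)
    have "y \<in> set r'" using r by simp
    then have "y \<in> set (s1 @ z # s2)" by (simp only: replace)
    then show ?thesis using replace by fastforce
  next
    case (keep s1 s2)
    then show ?thesis using r by simp
  qed
qed

section \<open>Two successive letters entering one row\<close>

lemma bump_mem: "bump r x y r' \<Longrightarrow> x < y \<and> y \<in> set r \<and> x \<in> set r'"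
  by (auto simp: bump_def)

text \<open>In the replacing case an entry of \<open>r'\<close> above \<open>y\<close> lies beyond
  the slot taken by \<open>x\<close>, hence exceeds \<open>x1\<close>; in the keeping case
  \<open>x1 = Suc x\<close> is at most \<open>y\<close>.\<close>

lemma bump_bump_less:
  assumes "bump r x x1 r'" "bump r' y y1 r''" "x < y"
  shows "x1 < y1"
proof -
  have y1: "y1 \<in> set r'" "y < y1" using bump_mem[OF assms(2)] by auto
  from assms(1) show ?thesis
    by (cases rule: bump_cases) (use y1 assms(3) in \<open>fastforce+\<close>)
qed

text \<open>\<open>x\<close> now sits in \<open>r'\<close>, so \<open>y\<close> bumps
  \<open>x\<close> or something smaller, while \<open>x1\<close> exceeds \<open>x\<close>.\<close>

lemma bump_bump_greater:
  assumes "bump r x x1 r'" "bump r' y y1 r''" "y < x"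
  shows "y1 < x1"
proof -
  have x: "x \<in> set r'" "x < x1" using bump_mem[OF assms(1)] by auto
  from assms(2) have "y1 \<le> x"
    by (cases rule: bump_cases) (use x assms(3) in \<open>fastforce+\<close>)
  then show ?thesis using x by simp
qed

section \<open>Edelman-Greene insertion\<close>

definition row_above :: "('a \<Rightarrow> 'a \<Rightarrow> bool) \<Rightarrow> 'a list \<Rightarrow> 'a list \<Rightarrow> bool" where
  "row_above R r s \<longleftrightarrow> length s \<le> length r \<and> (\<forall>j < length s. R (r ! j) (s ! j))"

lemma transp_row_above: "transp R \<Longrightarrow> transp (row_above R)"
  unfolding row_above_def transp_def by (meson order_less_le_trans order_trans)

lemma set_col: "set (col T b) = {s ! b |s. s \<in> set T \<and> b < length s}"
  by (auto simp: col_def)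

lemma col_Cons: "col (r # T) b = (if b < length r then r ! b # col T b else col T b)"
  by (simp add: col_def)

lemma young_shape_iff:
  "young_shape T \<longleftrightarrow> [] \<notin> set T \<and> sorted_wrt (\<lambda>r s. length s \<le> length r) T"
proof -
  have "transp (\<lambda>r s :: 'a list. length s \<le> length r)"
    by (auto intro: transpI)
  then show ?thesis
    by (auto simp: young_shape_def sorted_wrt_iff_nth_Suc_transp)
qed

lemma young_shape_Cons:
  "young_shape (r # T) \<longleftrightarrow> r \<noteq> [] \<and> (\<forall>s \<in> set T. length s \<le> length r) \<and> young_shape T"
  by (auto simp: young_shape_iff)

text \<open>In a Young diagram all rows above one that reaches column \<open>b\<close> reach it too,
  so comparing within columns means comparing any two rows along the lower one. \<open>R\<close> is
  arbitrary because both \<open>(<)\<close> and \<open>col_le\<close> are needed.\<close>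

lemma columns_iff:
  "young_shape T \<and> (\<forall>b. sorted_wrt R (col T b)) \<longleftrightarrow> [] \<notin> set T \<and> sorted_wrt (row_above R) T"
proof (induction T)
  case Nil
  then show ?case by (simp add: young_shape_def col_def)
next
  case (Cons r T)
  have "(\<forall>b. sorted_wrt R (col (r # T) b)) \<longleftrightarrow>
      (\<forall>s \<in> set T. \<forall>b < length s. b < length r \<longrightarrow> R (r ! b) (s ! b)) \<and>
      (\<forall>b. sorted_wrt R (col T b))"
    by (auto simp: col_Cons set_col)
  then show ?case
    using Cons.IH by (auto simp: young_shape_Cons row_above_def)
qed

definition tableau :: "nat list list \<Rightarrow> bool" where
  "tableau T \<longleftrightarrow> [] \<notin> set T \<and> (\<forall>r \<in> set T. sorted_wrt (<) r) \<and> sorted_wrt (row_above (<)) T"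

lemma tableau_Nil [simp]: "tableau []"
  by (simp add: tableau_def)

lemma tableau_Cons:
  "tableau (r # T) \<longleftrightarrow>
     r \<noteq> [] \<and> sorted_wrt (<) r \<and> (T \<noteq> [] \<longrightarrow> row_above (<) r (hd T)) \<and> tableau T"
proof (cases T)
  case (Cons s T')
  have "transp (row_above ((<) :: nat \<Rightarrow> nat \<Rightarrow> bool))"
    by (intro transp_row_above) simp
  then show ?thesis
    by (auto simp: Cons tableau_def sorted_wrt2 simp del: sorted_wrt.simps(2))
qed (auto simp: tableau_def)

lemma tableau_young_shape: "tableau T \<Longrightarrow> young_shape T"
  using columns_iff[of T "(<)"] by (simp add: tableau_def)

section \<open>Adjacent rows under bumping\<close>

lemma bump_nth:
  assumes "bump r x y r'"
  obtains p where "p < length r" "r ! p = y"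
    "r' = r[p := x] \<or> (r' = r \<and> 0 < p \<and> r ! (p - 1) = x \<and> y = Suc x)"
  using assms
proof (cases rule: bump_cases)
  case (replace r1 r2)
  then show ?thesis by (intro that[of "length r1"]) auto
next
  case (keep r1 r2)
  then show ?thesis by (intro that[of "Suc (length r1)"]) (auto simp: nth_append)
qed

lemma nth_mono:
  assumes "sorted_wrt (<) r" "i < length r" "j < length r"
  shows "r ! i < (r ! j :: nat) \<longleftrightarrow> i < j"
  using assms sorted_wrt_nth_less[of "(<)" r] by (metis linorder_neqE_nat order_less_asym)

text \<open>The bumped \<open>y\<close> lands weakly left of its old column \<open>p\<close>: all of
  \<open>s\<close> is below \<open>y\<close>, so column strictness gives
  \<open>length s \<le> p\<close>. Equality with a kept \<open>x\<close> is impossible, since the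
  entry of \<open>s\<close> under \<open>x\<close> would lie strictly between \<open>x\<close> and
  \<open>Suc x\<close>.\<close>

lemma row_above_append_forward:
  assumes "bump r x y r'" "row_above (<) r s" "\<forall>z \<in> set s. z < y"
  shows "row_above (<) r' (s @ [y])"
proof -
  obtain p where p: "p < length r" "r ! p = y"
    "r' = r[p := x] \<or> (r' = r \<and> 0 < p \<and> r ! (p - 1) = x \<and> y = Suc x)"
    using bump_nth[OF assms(1)] by blast
  have sr: "sorted_wrt (<) r" and xy: "x < y" and len: "length r' = length r"
    using assms(1) bump_length by (auto simp: bump_def)
  have s: "j < length r" "r ! j < s ! j" "s ! j < y" if "j < length s" for j
    using that assms(2,3) by (auto simp: row_above_def)
  have lp: "length s \<le> p"
    using s[of p] p(2) by (meson not_less not_less_iff_gr_or_eq)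
  have le: "r' ! j \<le> r ! j" if "j < length r" for j
    using p xy that by (auto simp: nth_list_update)
  have "r' ! length s < y"
  proof (cases "length s < p")
    case True
    then have "r ! length s < y" using nth_mono[OF sr, of "length s" p] p by simp
    then show ?thesis using le[of "length s"] True p(1) by simp
  next
    case False
    then have ls: "length s = p" using lp by simp
    show ?thesis
    proof (cases "r' = r[p := x]")
      case True
      then show ?thesis using ls p(1) xy by simp
    next
      case False
      then have "0 < p" "r ! (p - 1) = x" "y = Suc x" using p by auto
      then show ?thesis using s[of "p - 1"] ls by simp
    qed
  qed
  moreover have "r' ! j < s ! j" if "j < length s" for j
    using s[OF that] le[of j] by simp
  ultimately show ?thesis
    using lp p(1) len by (auto simp: row_above_def nth_append less_Suc_eq)
qed

text \<open>Upper entries never grow, so only a lowered entry at \<open>q\<close> is critical. Then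
  again \<open>q \<le> p\<close>, and for \<open>q = p\<close> with \<open>x\<close> kept, the entry
  under \<open>x\<close> would lie strictly between \<open>x\<close> and
  \<open>Suc x\<close>.\<close>

lemma row_above_bump_forward:
  assumes "bump r x y r'" "row_above (<) r s" "bump s y z s'"
  shows "row_above (<) r' s'"
proof -
  obtain p where p: "p < length r" "r ! p = y"
    "r' = r[p := x] \<or> (r' = r \<and> 0 < p \<and> r ! (p - 1) = x \<and> y = Suc x)"
    using bump_nth[OF assms(1)] by blast
  obtain q where q: "q < length s" "s ! q = z"
    "s' = s[q := y] \<or> (s' = s \<and> 0 < q \<and> s ! (q - 1) = y \<and> z = Suc y)"
    using bump_nth[OF assms(3)] by blast
  have sr: "sorted_wrt (<) r" and xy: "x < y" and len: "length r' = length r" "length s' = length s"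
    and ss: "sorted_wrt (<) s'"
    using assms bump_length by (auto simp: bump_def)
  have s: "j < length r" "r ! j < s ! j" if "j < length s" for j
    using that assms(2) by (auto simp: row_above_def)
  have le: "r' ! j \<le> r ! j" if "j < length r" for j
    using p xy that by (auto simp: nth_list_update)
  have "r' ! q < y" if s': "s' = s[q := y]"
  proof -
    have small: "s ! j < y" if "j < q" for j
      using nth_mono[OF ss, of j q] that s' q(1) by simp
    have "q \<le> p"
      using small[of p] s[of p] p(2) q(1) by (meson less_trans not_less not_less_iff_gr_or_eq)
    show ?thesis
    proof (cases "q < p")
      case True
      then have "r ! q < y" using nth_mono[OF sr, of q p] p by simp
      then show ?thesis using le[of q] True p(1) by simp
    next
      case False
      then have pq: "q = p" using \<open>q \<le> p\<close> by simp
      show ?thesis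
      proof (cases "r' = r[p := x]")
        case True
        then show ?thesis using pq p(1) xy by simp
      next
        case False
        then have "0 < p" "r ! (p - 1) = x" "y = Suc x" using p by auto
        moreover have "p - 1 < length s" "p - 1 < q" using pq q(1) \<open>0 < p\<close> by auto
        ultimately show ?thesis using s(2)[of "p - 1"] small[of "p - 1"] by simp
      qed
    qed
  qed
  then have "r' ! j < s' ! j" if "j < length s" for j
    using s[OF that] le[of j] q that by (cases "j = q") auto
  then show ?thesis
    using len assms(2) by (simp add: row_above_def)
qed

text \<open>Undoing the bump enlarges at most the entry at \<open>p\<close>, so it suffices that
  \<open>p\<close> is not a column of \<open>s\<close>: otherwise the entry of \<open>r'\<close>
  above the appended \<open>y\<close> would exceed \<open>y\<close>.\<close>

lemma row_above_append_backward:
  assumes "bump r x y r'" "row_above (<) r' (s @ [y])"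
  shows "row_above (<) r s"
proof -
  obtain p where p: "p < length r" "r ! p = y"
    "r' = r[p := x] \<or> (r' = r \<and> 0 < p \<and> r ! (p - 1) = x \<and> y = Suc x)"
    using bump_nth[OF assms(1)] by blast
  have sr: "sorted_wrt (<) r" and xy: "x < y" and len: "length r' = length r"
    using assms(1) bump_length by (auto simp: bump_def)
  have ls: "length s < length r" "r' ! length s < y"
    using assms(2) len by (auto simp: row_above_def nth_append)
  have s: "r' ! j < s ! j" if "j < length s" for j
  proof -
    have "r' ! j < (s @ [y]) ! j"
      using assms(2) that unfolding row_above_def by simp
    then show ?thesis using that by (simp add: nth_append)
  qed
  have "r ! j < s ! j" if j: "j < length s" for j
  proof (cases "r' = r")
    case True
    then show ?thesis using s j by simp
  next
    case False
    then have r': "r' = r[p := x]" using p by auto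
    have "\<not> p < length s"
    proof
      assume "p < length s"
      then have "y < r ! length s" using nth_mono[OF sr, of p "length s"] p ls by simp
      then show False using ls r' \<open>p < length s\<close> by simp
    qed
    then show ?thesis using s[OF j] j r' by auto
  qed
  then show ?thesis
    using ls by (simp add: row_above_def)
qed

text \<open>Only column \<open>p\<close> can get a larger upper entry, namely \<open>y\<close>. In
  that case \<open>q \<le> p\<close>, so the entry below it is at least
  \<open>z > y\<close>.\<close>

lemma row_above_bump_backward:
  assumes "bump r x y r'" "row_above (<) r' s'" "bump s y z s'"
  shows "row_above (<) r s"
proof -
  obtain p where p: "p < length r" "r ! p = y"
    "r' = r[p := x] \<or> (r' = r \<and> 0 < p \<and> r ! (p - 1) = x \<and> y = Suc x)"
    using bump_nth[OF assms(1)] by blast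
  obtain q where q: "q < length s" "s ! q = z"
    "s' = s[q := y] \<or> (s' = s \<and> 0 < q \<and> s ! (q - 1) = y \<and> z = Suc y)"
    using bump_nth[OF assms(3)] by blast
  have sr: "sorted_wrt (<) r" and yz: "y < z"
    and len: "length r' = length r" "length s' = length s"
    and ss: "sorted_wrt (<) s" "sorted_wrt (<) s'"
    using assms bump_length by (auto simp: bump_def)
  have s: "r' ! j < s' ! j" if "j < length s" for j
    using that assms(2) len by (auto simp: row_above_def)
  have le: "s' ! j \<le> s ! j" if "j < length s" for j
    using q yz that by (auto simp: nth_list_update)
  have "r ! j < s ! j" if j: "j < length s" for j
  proof (cases "r' = r \<or> j \<noteq> p")
    case True
    then have "r ! j = r' ! j" using p by auto
    then show ?thesis using s[OF j] le[OF j] by simp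
  next
    case False
    then have r': "r' = r[p := x]" and jp: "j = p" using p by auto
    have "r ! q = r' ! q" if "p < q" using r' that by simp
    \<comment> \<open>Only a weak bound: position \<open>q\<close> of \<open>s'\<close> holds
      \<open>y\<close> after a replacement, but \<open>z = Suc y\<close> if \<open>y\<close> was
      kept.\<close>
    moreover have "r' ! q \<le> y" using s[OF q(1)] q by auto
    moreover have "q < length r" using q(1) assms(2) len by (simp add: row_above_def)
    ultimately have "q \<le> p" using nth_mono[OF sr, of p q] p(1,2) by (metis leD leI)
    then have "z \<le> s ! p" using nth_mono[OF ss(1), of q p] q(2) j jp
      by (cases "q = p") auto
    then show ?thesis using p(2) yz jp by simp
  qed
  then show ?thesis
    using len assms(2) by (simp add: row_above_def)
qed

text \<open>A relation that holds only where each row step is a proper bump or an append beyond all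
  entries. The last argument is the row of the new box. \<open>r \<noteq> []\<close> keeps
  \<open>ins_append\<close> from overlapping with \<open>ins_Nil\<close> when read
  backwards.\<close>

inductive ins :: "nat \<Rightarrow> nat list list \<Rightarrow> nat list list \<Rightarrow> nat \<Rightarrow> bool" where
  ins_Nil: "ins x [] [[x]] 0"
| ins_append: "r \<noteq> [] \<Longrightarrow> \<forall>z \<in> set r. z < x \<Longrightarrow> ins x (r # rs) ((r @ [x]) # rs) 0"
| ins_bump: "bump r x y r' \<Longrightarrow> ins y rs T a \<Longrightarrow> ins x (r # rs) (r' # T) (Suc a)"

lemma reading_word_Cons [simp]: "reading_word (r # T) = reading_word T @ r"
  by (simp add: reading_word_def)

lemma reading_word_Nil [simp]: "reading_word [] = []"
  by (simp add: reading_word_def)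

text \<open>Lower rows come first in the reading word, so the \<open>y\<close> at the front of
  \<open>r'\<close> stands right behind the reading word of the rows that it enters.\<close>

lemma ins_cox_eq:
  assumes "ins x T T' a" "0 \<notin> set (reading_word T)" "0 < x"
  shows "cox_eq (reading_word T @ [x]) (reading_word T')"
  using assms
proof (induction rule: ins.induct)
  case (ins_bump r x y r' rs T a)
  have "0 < y" using ins_bump.hyps(1) bump_mem by fastforce
  have "cox_eq (reading_word rs @ r @ [x]) (reading_word rs @ y # r')"
    using ins_bump bump_cox_eq by (intro cox_eq_append) auto
  also have "cox_eq ((reading_word rs @ [y]) @ r') (reading_word T @ r')"
    using ins_bump \<open>0 < y\<close> by (intro cox_eq_append) auto
  then have "cox_eq (reading_word rs @ y # r') (reading_word T @ r')" by simp
  finally show ?case by simp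
qed auto

text \<open>Used backwards, to get positivity of \<open>x\<close> and of the entries of
  \<open>T\<close> from that of \<open>T'\<close>; \<open>ins_cox_eq\<close> cannot provide this,
  having it as a hypothesis.\<close>

lemma ins_set:
  assumes "ins x T T' a"
  shows "insert x (set (reading_word T)) \<subseteq> set (reading_word T')"
  using assms
proof (induction rule: ins.induct)
  case (ins_bump r x y r' rs T a)
  have "insert x (set r) \<subseteq> insert y (set r')"
    using ins_bump.hyps(1) by (auto simp: bump_def)
  then show ?case using ins_bump.IH by auto
qed auto

lemma ins_eg_ins:
  assumes "ins x T T' a"
  shows "\<exists>b. eg_ins x T = (T', (a, b))"
  using assms
proof (induction rule: ins.induct)
  case (ins_append r x rs)
  then have "find (\<lambda>y. x < y) r = None" by (auto simp: find_None_iff)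
  then show ?case by simp
next
  case (ins_bump r x y r' rs T a)
  then show ?case using bump_eg[OF ins_bump.hyps(1)] by (auto simp: Let_def)
qed simp

text \<open>\<open>bump_cox_eq\<close> rewrites the reading word at each row; the word passed to the
  lower rows is a prefix of the result, hence reduced again.\<close>

lemma ins_exists:
  assumes "red n (reading_word T @ [x])" "\<forall>r \<in> set T. r \<noteq> [] \<and> sorted_wrt (<) r"
  shows "\<exists>T' a. ins x T T' a"
  using assms
proof (induction T arbitrary: x)
  case Nil
  then show ?case using ins_Nil by blast
next
  case (Cons r rs)
  have red: "red n (r @ [x])"
    using Cons.prems(1) red_suffix[of n "reading_word rs" "r @ [x]"] by simp
  show ?case
  proof (cases "find (\<lambda>y. x < y) r")
    case None
    then have "\<forall>z \<in> set r. z < x"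
      using red_append_greatest[OF _ red] Cons.prems(2) by simp
    then show ?thesis using ins_append[of r x rs] Cons.prems(2) by auto
  next
    case (Some y)
    then obtain r' where b: "bump r x y r'"
      using bump_exists[OF _ red Some] Cons.prems(2) by auto
    have "cox_eq (reading_word rs @ r @ [x]) (reading_word rs @ y # r')"
      using bump_cox_eq[OF b] red_pos[OF red] by (intro cox_eq_append) auto
    then have "red n (reading_word rs @ y # r')"
      using Cons.prems(1) red_cox_eq by simp
    then have "red n (reading_word rs @ [y])"
      using red_prefix[of n "reading_word rs @ [y]" r'] by simp
    then obtain T' a where "ins y rs T' a" using Cons by fastforce
    then show ?thesis using ins_bump[OF b] by blast
  qed
qed

lemma ins_tableau:
  assumes "ins x T T' a" "tableau T"
  shows "tableau T'"
  using assms
proof (induction rule: ins.induct)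
  case (ins_append r x rs)
  have "row_above (<) (r @ [x]) (hd rs)" if "row_above (<) r (hd rs)"
    using that by (auto simp: row_above_def nth_append)
  then show ?case
    using ins_append by (auto simp: tableau_Cons sorted_wrt_append)
next
  case (ins_bump r x y r' rs T a)
  have "row_above (<) r' (hd T)"
    using ins_bump.hyps(2)
  proof cases
    \<comment> \<open>Opening a new bottom row counts as appending to an empty row.\<close>
    case ins_Nil
    then show ?thesis
      using row_above_append_forward[OF ins_bump.hyps(1), of "[]"] by (simp add: row_above_def)
  next
    case (ins_append s ss)
    then show ?thesis
      using row_above_append_forward[OF ins_bump.hyps(1)] ins_bump.prems by (simp add: tableau_Cons)
  next
    case (ins_bump s z s' ss T2 b)
    then have "row_above (<) r s" using \<open>tableau (r # rs)\<close> by (simp add: tableau_Cons)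
    with ins_bump show ?thesis
      using row_above_bump_forward[OF \<open>bump r x y r'\<close>] by simp
  qed
  then show ?case
    using ins_bump bump_length[OF ins_bump.hyps(1)] bump_sorted[OF ins_bump.hyps(1)]
    by (auto simp: tableau_Cons)
qed (simp add: tableau_Cons)

text \<open>The hypotheses on \<open>a\<close> say that row \<open>a\<close> ends in a corner. The
  conclusion \<open>x \<in> set (hd T')\<close> drives the induction: the \<open>y\<close> leaving
  the lower rows occurs in their top row, so the entry of \<open>r'\<close> above it is smaller, as
  \<open>bump_reverse_exists\<close> requires.\<close>

lemma ins_reverse_exists:
  assumes "tableau T'" "red n (reading_word T')" "a < length T'"
    "Suc a < length T' \<longrightarrow> length (T' ! Suc a) < length (T' ! a)"
  shows "\<exists>x T. ins x T T' a \<and> tableau T \<and> x \<in> set (hd T')"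
  using assms
proof (induction a arbitrary: T')
  case 0
  then obtain r' rs where T': "T' = r' # rs" by (cases T') auto
  then obtain r x where r': "r' = r @ [x]" using 0 by (metis rev_exhaust tableau_Cons)
  show ?case
  proof (cases "r = []")
    case True
    then have "rs = []" using 0 T' r' by (cases rs) (auto simp: tableau_Cons)
    then show ?thesis using True T' r' ins_Nil tableau_Nil by fastforce
  next
    case False
    have "ins x (r # rs) T' 0"
      using 0 T' r' False by (auto simp: tableau_Cons sorted_wrt_append intro: ins_append)
    moreover have "row_above (<) r (hd rs)" if "rs \<noteq> []"
    proof -
      have *: "row_above (<) r' (hd rs)" "length (hd rs) \<le> length r"
        using 0 T' r' that by (auto simp: tableau_Cons hd_conv_nth)
      then have "r ! j < hd rs ! j" if "j < length (hd rs)" for j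
        using that r' unfolding row_above_def by (metis nth_append order_less_le_trans)
      then show ?thesis using * by (simp add: row_above_def)
    qed
    then have "tableau (r # rs)"
      using 0 T' r' False by (auto simp: tableau_Cons sorted_wrt_append)
    ultimately show ?thesis using T' r' by auto
  qed
next
  case (Suc a)
  then obtain r' T1 where T': "T' = r' # T1" by (cases T') auto
  have tab: "tableau T1" and sr: "sorted_wrt (<) r'" and "T1 \<noteq> []"
    and above: "row_above (<) r' (hd T1)"
    using Suc.prems T' by (auto simp: tableau_Cons)
  have red: "red n (reading_word T1 @ r')" using Suc.prems T' by simp
  obtain y T0 where y: "ins y T0 T1 a" "tableau T0" "y \<in> set (hd T1)"
    using Suc.IH[of T1] tab red_prefix[OF red] Suc.prems T' by auto
  have "0 < y" using red_posD[OF red, of y] y(3) \<open>T1 \<noteq> []\<close> by (cases T1) auto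
  \<comment> \<open>Reducedness is known for the outcome only; the Coxeter move is run backwards to
    bring \<open>y\<close> in front of \<open>r'\<close>.\<close>
  have "0 \<notin> set (reading_word T0)"
    using ins_set[OF y(1)] red_pos[OF red] by auto
  then have "cox_eq ((reading_word T0 @ [y]) @ r') (reading_word T1 @ r')"
    using ins_cox_eq[OF y(1)] \<open>0 < y\<close> by (intro cox_eq_append) auto
  then have "red n (reading_word T0 @ y # r')" using red red_cox_eq by simp
  then have redy: "red n (y # r')" by (rule red_suffix)
  obtain j where "j < length (hd T1)" "hd T1 ! j = y"
    using y(3) by (auto simp: in_set_conv_nth)
  then have "\<exists>z \<in> set r'. z < y" using above by (force simp: row_above_def)
  then obtain r x where b: "bump r x y r'" "x \<in> set r'"
    using bump_reverse_exists[OF sr redy] by blast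
  have "row_above (<) r (hd T0)" if "T0 \<noteq> []"
    using y(1)
  proof cases
    case ins_Nil
    then show ?thesis using that by simp
  next
    case (ins_append s ss)
    then show ?thesis using row_above_append_backward[OF b(1)] above by simp
  next
    case (ins_bump s z s' ss T2 c)
    then show ?thesis using row_above_bump_backward[OF b(1)] above by simp
  qed
  then have "tableau (r # T0)"
    using y(2) bump_mem[OF b(1)] bump_sorted[OF b(1)] by (auto simp: tableau_Cons)
  moreover have "ins x (r # T0) T' (Suc a)" using ins_bump[OF b(1) y(1)] T' by simp
  ultimately show ?case using b(2) T' by auto
qed

text \<open>Once the row of the new box is fixed, the path is retraced upwards from there, with
  \<open>bump_inj\<close> leaving no choice.\<close>

lemma ins_inj:
  assumes "ins x T T' a" "ins y U T' a"
  shows "x = y \<and> T = U"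
  using assms
proof (induction arbitrary: y U rule: ins.induct)
  case (ins_Nil x)
  then show ?case by (auto elim: ins.cases)
next
  case (ins_append r x rs)
  then show ?case by (auto elim: ins.cases)
next
  case (ins_bump r x y r' rs T a)
  from ins_bump.prems obtain s z rs' where *: "U = s # rs'" "bump s y z r'" "ins z rs' T a"
    by (cases rule: ins.cases) auto
  then show ?case using ins_bump.IH[of z rs'] bump_inj[OF ins_bump.hyps(1)] by auto
qed

text \<open>\<open>x < y\<close> is inherited by the bumped letters; where the first path ends with
  an append, the larger letter exceeds the whole row and is appended too, if its path has come that
  far.\<close>

lemma ins_ins_less:
  assumes "ins x T T1 a" "ins y T1 T2 b" "x < y"
  shows "b \<le> a"
  using assms
proof (induction arbitrary: y T2 b rule: ins.induct)
  case (ins_Nil x)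
  from ins_Nil.prems(1) show ?case
  proof (cases rule: ins.cases)
    case (ins_bump z r' T c)
    then show ?thesis using bump_mem[of "[x]" y z r'] ins_Nil.prems(2) by simp
  qed simp
next
  case (ins_append r x rs)
  from ins_append.prems(1) show ?case
  proof (cases rule: ins.cases)
    case (ins_bump z r' T c)
    then show ?thesis
      using bump_mem[of "r @ [x]" y z r'] ins_append.hyps ins_append.prems(2) by fastforce
  qed simp
next
  case (ins_bump r x x1 r' rs T a)
  note IH = ins_bump.IH
  from ins_bump.prems(1) show ?case
  proof (cases rule: ins.cases)
    case (ins_bump z r'' T'' c)
    then show ?thesis
      using IH bump_bump_less[OF \<open>bump r x x1 r'\<close> _ \<open>x < y\<close>] by auto
  qed simp
qed

text \<open>A row that the first path visited contains the letter it brought there, which exceeds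
  the second one, so the second path cannot end in it. \<open>bump_bump_greater\<close> carries this
  down to row \<open>a\<close>.\<close>

lemma ins_ins_greater:
  assumes "ins x T T1 a" "ins y T1 T2 b" "y < x"
  shows "a < b"
  using assms
proof (induction arbitrary: y T2 b rule: ins.induct)
  case (ins_Nil x)
  from ins_Nil.prems show ?case
    by (cases rule: ins.cases) auto
next
  case (ins_append r x rs)
  from ins_append.prems show ?case
    by (cases rule: ins.cases) auto
next
  case (ins_bump r x x1 r' rs T a)
  note IH = ins_bump.IH
  from ins_bump.prems(1) show ?case
  proof (cases rule: ins.cases)
    case ins_append
    then show ?thesis using bump_mem[OF \<open>bump r x x1 r'\<close>] \<open>y < x\<close> by fastforce
  next
    case (ins_bump z r'' T'' c)
    then show ?thesis
      using IH bump_bump_greater[OF \<open>bump r x x1 r'\<close> _ \<open>y < x\<close>] by auto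
  qed
qed

section \<open>Primed tableaux\<close>

lemma add_cell_simps [simp]:
  "add_cell a l [] = [[l]]"
  "add_cell 0 l (q # Q) = (q @ [l]) # Q"
  "add_cell (Suc a) l (q # Q) = q # add_cell a l Q"
  by (auto simp: add_cell_def)

text \<open>In the absence of empty rows, extending row \<open>a\<close> and opening it as a new row
  are distinguishable.\<close>

lemma add_cell_inj:
  assumes "add_cell a l Q = add_cell a l Q'" "a \<le> length Q" "a \<le> length Q'"
    "[] \<notin> set Q" "[] \<notin> set Q'"
  shows "Q = Q'"
  using assms
proof (induction Q arbitrary: a Q')
  case Nil
  then show ?case by (cases Q') auto
next
  case (Cons q Q)
  then show ?case by (cases Q'; cases a) auto
qed

lemma shape_add_cell:
  assumes "map length Q = map length T"
  shows "map length (add_cell a l Q) = map length (add_cell a m T)"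
  using assms
proof (induction Q arbitrary: a T)
  case (Cons q Q)
  then show ?case by (cases T; cases a) auto
qed simp

lemma shape_add_cell_inj:
  assumes "map length (add_cell a l Q) = map length (add_cell a m T)"
    "a \<le> length Q" "a \<le> length T" "[] \<notin> set Q" "[] \<notin> set T"
  shows "map length Q = map length T"
  using assms
proof (induction Q arbitrary: a T)
  case Nil
  then show ?case by (cases T) auto
next
  case (Cons q Q)
  then show ?case by (cases T; cases a) auto
qed

lemma ins_shape:
  assumes "ins x T T' a"
  shows "map length T' = map length (add_cell a x T) \<and> a \<le> length T"
  using assms
proof (induction rule: ins.induct)
  case (ins_bump r x y r' rs T a)
  then show ?case
    using shape_add_cell[of rs rs a y x] bump_length by auto
qed auto

lemma count_list_add_cell:
  "count_list (concat (add_cell a l Q)) z = count_list (concat Q) z + (if l = z then 1 else 0)"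
proof (induction Q arbitrary: a)
  case (Cons q Q)
  then show ?case by (cases a) auto
qed simp

lemma young_shape_cong:
  assumes "map length Q = map length P" "young_shape P"
  shows "young_shape Q"
proof -
  have len: "length Q = length P" using assms(1) by (metis length_map)
  have "length (Q ! i) = length (P ! i)" if "i < length P" for i
    using assms(1) that len by (metis nth_map)
  then show ?thesis
    using assms(2) len unfolding young_shape_def by (metis add_lessD1 in_set_conv_nth length_0_conv)
qed

section \<open>Primed tableaux through pairs of entries\<close>

definition is_primed :: "primed \<Rightarrow> bool" where
  "is_primed p \<longleftrightarrow> (\<exists>i. p = Primed i)"

lemma is_primed_simps [simp]: "is_primed (Primed i)" "\<not> is_primed (Unprimed i)"
  by (auto simp: is_primed_def)

text \<open>Together with \<open>col_le\<close>, turns the bounds on multiplicities into conditions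
  on pairs, so that \<open>sorted_wrt\<close> and \<open>row_above\<close> serve here as they do for
  \<open>tableau\<close>.\<close>

definition row_le :: "primed \<Rightarrow> primed \<Rightarrow> bool" where
  "row_le p q \<longleftrightarrow> prank p < prank q \<or> p = q \<and> \<not> is_primed p"

definition col_le :: "primed \<Rightarrow> primed \<Rightarrow> bool" where
  "col_le p q \<longleftrightarrow> prank p < prank q \<or> p = q \<and> is_primed p"

text \<open>The alphabet excludes index 0, where \<open>2 * i - 1\<close> truncates to 0 and both
  kinds of letter share a rank.\<close>

lemma prank_inj: "in_alphabet k p \<Longrightarrow> in_alphabet k q \<Longrightarrow> prank p = prank q \<Longrightarrow> p = q"
  by (cases p; cases q) (simp_all, presburger+)

text \<open>\<open>S\<close> marks the letters that may not repeat: \<open>is_primed\<close> for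
  rows, its negation for columns.\<close>

lemma sorted_count_iff:
  assumes "\<forall>p \<in> set r. in_alphabet k p"
  shows "sorted (map prank r) \<and> (\<forall>z. S z \<longrightarrow> count_list r z \<le> 1) \<longleftrightarrow>
    sorted_wrt (\<lambda>p q. prank p < prank q \<or> p = q \<and> \<not> S p) r"
  using assms
proof (induction r)
  case (Cons p r)
  have le: "prank p \<le> prank q \<longleftrightarrow> prank p < prank q \<or> p = q" if "q \<in> set r" for q
    using prank_inj[of k p q] Cons.prems that by (auto simp: le_less)
  have "(S z \<longrightarrow> count_list (p # r) z \<le> 1) \<longleftrightarrow>
      (S z \<longrightarrow> (z = p \<longrightarrow> p \<notin> set r) \<and> count_list r z \<le> 1)" for z
    using count_list_0_iff[of r p] by (cases "z = p") auto
  then have "(\<forall>z. S z \<longrightarrow> count_list (p # r) z \<le> 1) \<longleftrightarrow>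
      (S p \<longrightarrow> p \<notin> set r) \<and> (\<forall>z. S z \<longrightarrow> count_list r z \<le> 1)"
    by blast
  then show ?case
    using Cons le by auto
qed simp

definition qtab :: "nat \<Rightarrow> primed list list \<Rightarrow> bool" where
  "qtab k Q \<longleftrightarrow> [] \<notin> set Q \<and> (\<forall>r \<in> set Q. \<forall>x \<in> set r. in_alphabet k x) \<and>
     (\<forall>r \<in> set Q. sorted_wrt row_le r) \<and> sorted_wrt (row_above col_le) Q"

lemma primed_tableau_iff: "primed_tableau k Q \<longleftrightarrow> qtab k Q"
proof (cases "\<forall>r \<in> set Q. \<forall>x \<in> set r. in_alphabet k x")
  case True
  have row: "sorted (map prank r) \<and> (\<forall>i. count_list r (Primed i) \<le> 1) \<longleftrightarrow> sorted_wrt row_le r"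
    if "r \<in> set Q" for r
  proof -
    have "(\<forall>i. count_list r (Primed i) \<le> 1) \<longleftrightarrow> (\<forall>z. is_primed z \<longrightarrow> count_list r z \<le> 1)"
      by (auto simp: is_primed_def)
    then show ?thesis
      using sorted_count_iff[of r k is_primed] True that by (simp add: row_le_def[abs_def])
  qed
  have col: "sorted (map prank (col Q b)) \<and> (\<forall>i. count_list (col Q b) (Unprimed i) \<le> 1) \<longleftrightarrow>
      sorted_wrt col_le (col Q b)" for b
  proof -
    have "\<forall>x \<in> set (col Q b). in_alphabet k x"
      using True by (auto simp: set_col)
    moreover have "(\<forall>i. count_list (col Q b) (Unprimed i) \<le> 1) \<longleftrightarrow>
        (\<forall>z. \<not> is_primed z \<longrightarrow> count_list (col Q b) z \<le> 1)"
      by (metis is_primed_def is_primed_simps(2) primed.exhaust)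
    ultimately show ?thesis
      using sorted_count_iff[of "col Q b" k "\<lambda>z. \<not> is_primed z"] by (simp add: col_le_def[abs_def])
  qed
  show ?thesis
    unfolding primed_tableau_def qtab_def using row col columns_iff[of Q col_le] True by blast
next
  case False
  then show ?thesis by (auto simp: primed_tableau_def qtab_def)
qed

text \<open>Row \<open>a\<close> holds the box that was added last: the largest label \<open>l\<close> occupies a vertical strip
  filled downwards if it is primed, and a horizontal strip filled upwards otherwise.\<close>

definition last_box :: "primed list list \<Rightarrow> primed \<Rightarrow> nat \<Rightarrow> bool" where
  "last_box Q l a \<longleftrightarrow> a < length Q \<and> (\<forall>r \<in> set Q. \<forall>z \<in> set r. prank z \<le> prank l) \<and> l \<in> set (Q ! a) \<and>
     (if is_primed l then \<forall>r \<in> set (drop (Suc a) Q). l \<notin> set r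
      else \<forall>r \<in> set (take a Q). l \<notin> set r)"

text \<open>The new \<open>l\<close> has to come after every old \<open>l\<close> in the filling
  order of \<open>last_box\<close>. The primed case has \<open>drop a\<close> rather than
  \<open>drop (Suc a)\<close>, as row \<open>a\<close> must not hold a second
  \<open>l\<close>.\<close>

definition addable :: "primed list list \<Rightarrow> primed \<Rightarrow> nat \<Rightarrow> bool" where
  "addable Q l a \<longleftrightarrow> a \<le> length Q \<and>
     (if is_primed l then \<forall>r \<in> set (drop a Q). l \<notin> set r
      else \<forall>r \<in> set (take a Q). l \<notin> set r)"

lemma last_box_unique:
  assumes "last_box Q l a" "last_box Q l' a'" "qtab k Q"
  shows "l = l' \<and> a = a'"
proof -
  have "prank l = prank l'"
    using assms(1,2) by (auto simp: last_box_def intro!: order_antisym)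
  moreover have "in_alphabet k l" "in_alphabet k l'"
    using assms by (auto simp: last_box_def qtab_def)
  ultimately have l: "l = l'" using prank_inj by blast
  have "\<not> b < c" if "last_box Q l b" "last_box Q l c" for b c
  proof
    assume "b < c"
    have "c < length Q" using that(2) by (simp add: last_box_def)
    have "Q ! b \<in> set (take c Q)"
      using \<open>b < c\<close> \<open>c < length Q\<close> nth_mem[of b "take c Q"] by simp
    moreover have "Q ! c \<in> set (drop (Suc b) Q)"
      using \<open>b < c\<close> \<open>c < length Q\<close> nth_mem[of "c - Suc b" "drop (Suc b) Q"] by simp
    ultimately show False using that by (cases "is_primed l") (auto simp: last_box_def)
  qed
  then show ?thesis using assms(1,2) l by (meson linorder_neqE_nat)
qed

text \<open>A new row is viewed as an extended row \<open>r = []\<close>, which unifies the two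
  branches of \<open>add_cell\<close>.\<close>

lemma add_cell_split:
  assumes "a \<le> length Q"
  obtains Q1 r Q2 where "length Q1 = a" "add_cell a l Q = Q1 @ (r @ [l]) # Q2" "take a Q = Q1"
    "(drop a Q = r # Q2 \<and> Q = Q1 @ r # Q2) \<or> (drop a Q = [] \<and> r = [] \<and> Q2 = [] \<and> Q = Q1)"
proof (cases "a < length Q")
  case True
  have Q: "Q = take a Q @ Q ! a # drop (Suc a) Q" using True by (simp add: id_take_nth_drop)
  moreover have "drop a Q = Q ! a # drop (Suc a) Q" using True by (simp add: Cons_nth_drop_Suc)
  moreover have "add_cell a l Q = take a Q @ (Q ! a @ [l]) # drop (Suc a) Q"
    using True by (simp add: add_cell_def upd_conv_take_nth_drop)
  ultimately show ?thesis using True by (intro that[of "take a Q" "Q ! a" "drop (Suc a) Q"]) auto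
next
  case False
  then show ?thesis using assms by (intro that[of Q "[]" "[]"]) (auto simp: add_cell_def)
qed

text \<open>Only comparisons with the new box are at stake. An equal entry to its left matters for
  primed \<open>l\<close>, one above it for unprimed \<open>l\<close>, and \<open>addable\<close>
  excludes precisely these.\<close>

lemma qtab_add_cell:
  assumes "qtab k Q" "young_shape (add_cell a l Q)" "addable Q l a" "in_alphabet k l"
    and le: "\<forall>r \<in> set Q. \<forall>z \<in> set r. prank z \<le> prank l"
  shows "qtab k (add_cell a l Q) \<and> last_box (add_cell a l Q) l a"
proof -
  obtain Q1 r Q2 where Q: "length Q1 = a" "add_cell a l Q = Q1 @ (r @ [l]) # Q2" "take a Q = Q1"
    "(drop a Q = r # Q2 \<and> Q = Q1 @ r # Q2) \<or> (drop a Q = [] \<and> r = [] \<and> Q2 = [] \<and> Q = Q1)"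
    using add_cell_split[of a Q l] assms(3) unfolding addable_def by metis
  have lt: "prank z < prank l \<or> z = l" if "q \<in> set Q" "z \<in> set q" for q z
    using le that prank_inj[of k z l] assms(1,4) unfolding qtab_def
    by (meson le_neq_implies_less)
  have sub: "q \<in> set Q" if "q \<in> set Q1 \<or> q \<in> set Q2" for q
    using Q(4) that by auto
  have r: "r = [] \<or> r \<in> set Q" using Q(4) by auto
  have "sorted_wrt row_le (r @ [l])"
  proof -
    have "sorted_wrt row_le r" using r assms(1) by (auto simp: qtab_def)
    moreover have "row_le z l" if "z \<in> set r" for z
    proof -
      have "r \<in> set (drop a Q)" using Q(4) that by auto
      then have "z \<noteq> l \<or> \<not> is_primed l"
        using assms(3) that by (auto simp: addable_def)
      then show ?thesis using lt[of r z] r that by (auto simp: row_le_def)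
    qed
    ultimately show ?thesis by (auto simp: sorted_wrt_append)
  qed
  moreover have "row_above col_le q (r @ [l])" if q: "q \<in> set Q1" for q
  proof -
    have len: "length (r @ [l]) \<le> length q"
      using assms(2) q unfolding Q(2) young_shape_iff by (auto simp: sorted_wrt_append)
    have "r = [] \<or> row_above col_le q r"
      using Q(4) assms(1) q by (auto simp: qtab_def sorted_wrt_append)
    moreover have "col_le (q ! length r) l"
    proof -
      have m: "q ! length r \<in> set q" using len by simp
      then have "q ! length r \<noteq> l \<or> is_primed l"
        using assms(3) q Q(3) by (cases "is_primed l") (auto simp: addable_def)
      then show ?thesis using lt[OF sub m] q by (auto simp: col_le_def)
    qed
    ultimately show ?thesis
      using len by (auto simp: row_above_def nth_append less_Suc_eq)
  qed
  moreover have "row_above col_le (r @ [l]) q" if q: "q \<in> set Q2" for q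
  proof -
    have "row_above col_le r q"
      using Q(4) assms(1) q by (auto simp: qtab_def sorted_wrt_append)
    then show ?thesis by (auto simp: row_above_def nth_append)
  qed
  moreover have "sorted_wrt (row_above col_le) (Q1 @ Q2)"
    using Q(4) assms(1) by (auto simp: qtab_def sorted_wrt_append)
  ultimately have "qtab k (add_cell a l Q)"
    using assms(1,4) Q(4) unfolding Q(2) qtab_def by (auto simp: sorted_wrt_append)
  moreover have "last_box (add_cell a l Q) l a"
    using assms(3) Q le r sub unfolding Q(2) last_box_def addable_def by (auto simp: nth_append)
  ultimately show ?thesis ..
qed

lemma row_above_append:
  assumes "row_above R q (r @ s)"
  shows "row_above R q r"
proof -
  have "R (q ! j) ((r @ s) ! j)" if "j < length r" for j
    using assms that by (simp add: row_above_def)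
  then show ?thesis using assms by (simp add: row_above_def nth_append)
qed

text \<open>Of the rows holding the largest label, the lowest is taken if the label is primed and
  the highest otherwise. This row ends in \<open>l\<close>, and a box below that end would hold
  \<open>l\<close> again by maximality: impossible by \<open>col_le\<close> for unprimed
  \<open>l\<close>, by the choice of row for primed \<open>l\<close>. So it is a corner.\<close>

lemma qtab_remove:
  assumes "qtab k Q" "Q \<noteq> []"
  obtains l a Q0 where "Q = add_cell a l Q0" "qtab k Q0" "addable Q0 l a" "in_alphabet k l"
    "a < length Q" "Suc a < length Q \<longrightarrow> length (Q ! Suc a) < length (Q ! a)"
    "\<forall>r \<in> set Q0. \<forall>z \<in> set r. prank z \<le> prank l"
proof -
  have "set (concat Q) \<noteq> {}" using assms by (cases Q) (auto simp: qtab_def)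
  then have "Max (prank ` set (concat Q)) \<in> prank ` set (concat Q)"
    by (intro Max_in) auto
  then obtain l where l: "l \<in> set (concat Q)" "prank l = Max (prank ` set (concat Q))"
    by (metis imageE)
  then have le: "prank z \<le> prank l" if "z \<in> set q" "q \<in> set Q" for z q
    using that by (auto intro!: Max_ge)
  have ex: "\<exists>r \<in> set Q. l \<in> set r" using l(1) by simp
  have "\<exists>Q1 r Q2. Q = Q1 @ r # Q2 \<and> l \<in> set r \<and>
      (if is_primed l then \<forall>s \<in> set Q2. l \<notin> set s else \<forall>s \<in> set Q1. l \<notin> set s)"
  proof (cases "is_primed l")
    case True
    then show ?thesis using split_list_last_prop[OF ex] by simp
  next
    case False
    then show ?thesis using split_list_first_prop[OF ex] by simp
  qed
  then obtain Q1 r Q2 where Q: "Q = Q1 @ r # Q2" "l \<in> set r"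
    "if is_primed l then \<forall>s \<in> set Q2. l \<notin> set s else \<forall>s \<in> set Q1. l \<notin> set s"
    by blast
  have al: "in_alphabet k l" using assms(1) l(1) by (auto simp: qtab_def)
  have eq: "z = l" if "z \<in> set q" "q \<in> set Q" "prank l \<le> prank z" for z q
    using le[OF that(1,2)] that prank_inj[of k z l] assms(1) al unfolding qtab_def by auto
  obtain r0 m where r0: "r = r0 @ [m]" using Q(2) by (metis empty_iff list.set(1) rev_exhaust)
  have srt: "sorted_wrt row_le (r0 @ [m])" using assms(1) Q(1) r0 by (auto simp: qtab_def)
  have "m = l"
  proof (cases "l \<in> set r0")
    case True
    then have "prank l \<le> prank m" using srt by (auto simp: sorted_wrt_append row_le_def)
    then show ?thesis using eq[of m r] Q(1) r0 by simp
  qed (use Q(2) r0 in auto)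
  have short: "length s \<le> length r0" if s: "s \<in> set Q2" for s
  proof (rule ccontr)
    assume long: "\<not> length s \<le> length r0"
    have "row_above col_le r s" using assms(1) Q(1) s by (auto simp: qtab_def sorted_wrt_append)
    then have c: "col_le l (s ! length r0)"
      using long r0 \<open>m = l\<close> by (auto simp: row_above_def dest!: spec[of _ "length r0"])
    moreover have "s ! length r0 \<in> set s" using long by simp
    moreover from this c have "s ! length r0 = l"
      using eq[of "s ! length r0" s] Q(1) s by (auto simp: col_le_def)
    ultimately show False using Q(3) s by (auto simp: col_le_def split: if_splits)
  qed
  \<comment> \<open>A row that becomes empty has to disappear; by \<open>short\<close> there is
    nothing below it.\<close>
  define Q0 where "Q0 = (if r0 = [] then Q1 else Q1 @ r0 # Q2)"
  have Q2: "Q2 = []" if "r0 = []"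
    using short that assms(1) Q(1) by (cases Q2) (auto simp: qtab_def)
  have "Q = add_cell (length Q1) l Q0"
    using Q(1) r0 \<open>m = l\<close> Q2 by (auto simp: Q0_def add_cell_def)
  moreover have "qtab k Q0"
  proof -
    have "row_above col_le r0 s" if s: "s \<in> set Q2" for s
    proof -
      have "row_above col_le r s" using assms(1) Q(1) s by (auto simp: qtab_def sorted_wrt_append)
      then show ?thesis using short[OF s] r0 by (auto simp: row_above_def nth_append)
    qed
    moreover have "row_above col_le q r0" if q: "q \<in> set Q1" for q
    proof -
      have "row_above col_le q r" using assms(1) Q(1) q by (auto simp: qtab_def sorted_wrt_append)
      then show ?thesis using r0 row_above_append by blast
    qed
    ultimately show ?thesis
      using assms(1) Q(1) r0 Q2 by (auto simp: Q0_def qtab_def sorted_wrt_append)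
  qed
  moreover have "addable Q0 l (length Q1)"
  proof -
    have "l \<notin> set r0" if "is_primed l"
      using srt \<open>m = l\<close> that by (auto simp: sorted_wrt_append row_le_def)
    then show ?thesis using Q(3) Q2 by (auto simp: addable_def Q0_def)
  qed
  moreover have "length Q1 < length Q" using Q(1) by simp
  moreover have "Suc (length Q1) < length Q \<longrightarrow>
      length (Q ! Suc (length Q1)) < length (Q ! length Q1)"
    using Q(1) r0 short by (cases Q2) (auto simp: nth_append less_Suc_eq_le)
  moreover have "\<forall>q \<in> set Q0. \<forall>z \<in> set q. \<exists>q' \<in> set Q. z \<in> set q'"
    using Q(1) r0 by (auto simp: Q0_def)
  then have "\<forall>q \<in> set Q0. \<forall>z \<in> set q. prank z \<le> prank l" using le by blast
  ultimately show ?thesis using that al by blast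
qed

section \<open>Recording a labelled word\<close>

text \<open>A primed label stands for a negative letter, so at equal primed labels the absolute
  values compare in reverse.\<close>

definition lab_less :: "nat \<times> primed \<Rightarrow> nat \<times> primed \<Rightarrow> bool" where
  "lab_less u v \<longleftrightarrow> prank (snd u) < prank (snd v) \<or>
     snd u = snd v \<and> (if is_primed (snd u) then fst v < fst u else fst u < fst v)"

lemma transp_lab_less: "transp lab_less"
  by (auto simp: lab_less_def intro!: transpI split: if_splits)

lemma sorted_wrt_snoc:
  assumes "transp R" "sorted_wrt R L" "L \<noteq> [] \<longrightarrow> R (last L) z"
  shows "sorted_wrt R (L @ [z])"
proof (cases L rule: rev_cases)
  case (snoc L' y)
  then show ?thesis using assms by (auto simp: sorted_wrt_append dest: transpD)
qed simp

definition labelled_word :: "nat \<Rightarrow> nat \<Rightarrow> (nat \<times> primed) list \<Rightarrow> bool" where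
  "labelled_word n k L \<longleftrightarrow> sorted_wrt lab_less L \<and> (\<forall>p \<in> set L. in_alphabet k (snd p)) \<and>
     red n (map fst L)"

definition record_ins :: "(nat \<times> primed) list \<Rightarrow> nat list list \<times> primed list list" where
  "record_ins L = foldl pr_step ([], []) L"

lemma record_ins_Nil [simp]: "record_ins [] = ([], [])"
  by (simp add: record_ins_def)

lemma record_ins_snoc:
  assumes "record_ins L = (P, Q)" "ins x P P' a"
  shows "record_ins (L @ [(x, l)]) = (P', add_cell a l Q)"
  using ins_eg_ins[OF assms(2)] assms(1) by (auto simp: record_ins_def pr_step_def)

text \<open>The invariant of recording. Its last clause remembers the final insertion and the row it
  filled, against which the next box is compared.\<close>

definition recorded :: "nat \<Rightarrow> (nat \<times> primed) list \<Rightarrow> nat list list \<Rightarrow> primed list list \<Rightarrow> bool" where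
  "recorded k L P Q \<longleftrightarrow> record_ins L = (P, Q) \<and> tableau P \<and> qtab k Q \<and>
     map length Q = map length P \<and> cox_eq (map fst L) (reading_word P) \<and>
     (\<forall>z. count_list (concat Q) z = count_list (map snd L) z) \<and>
     (L \<noteq> [] \<longrightarrow> (\<exists>P0 a. ins (fst (last L)) P0 P a \<and> last_box Q (snd (last L)) a))"

lemma labelled_word_butlast: "labelled_word n k (L @ [p]) \<Longrightarrow> labelled_word n k L"
  using red_prefix[of n "map fst L" "[fst p]"] by (auto simp: labelled_word_def sorted_wrt_append)

lemma recorded_step:
  assumes L: "labelled_word n k (L @ [(x, l)])" and "recorded k L P0 Q0"
  shows "\<exists>P a. ins x P0 P a \<and> addable Q0 l a \<and> recorded k (L @ [(x, l)]) P (add_cell a l Q0)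
    \<and> last_box (add_cell a l Q0) l a"
proof -
  have rec: "record_ins L = (P0, Q0)" "tableau P0" "qtab k Q0" "map length Q0 = map length P0"
    "cox_eq (map fst L) (reading_word P0)"
    "\<And>z. count_list (concat Q0) z = count_list (map snd L) z"
    "L \<noteq> [] \<longrightarrow> (\<exists>P1 b. ins (fst (last L)) P1 P0 b \<and> last_box Q0 (snd (last L)) b)"
    using assms(2) by (auto simp: recorded_def)
  have lenQ: "length Q0 = length P0" using rec(4) by (metis length_map)
  have labels: "z \<in> set (concat Q0) \<longleftrightarrow> z \<in> snd ` set L" for z
    using rec(6)[of z] count_list_0_iff[of "concat Q0" z] count_list_0_iff[of "map snd L" z]
    by (metis list.set_map)
  have al: "in_alphabet k l" using L by (simp add: labelled_word_def)
  have ord: "lab_less p (x, l)" if "p \<in> set L" for p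
    using L that by (simp add: labelled_word_def sorted_wrt_append)
  have le: "\<forall>r \<in> set Q0. \<forall>z \<in> set r. prank z \<le> prank l"
  proof (intro ballI)
    fix r z assume "r \<in> set Q0" "z \<in> set r"
    then have "z \<in> snd ` set L" using labels[of z] by auto
    then obtain p where "p \<in> set L" "z = snd p" by blast
    then show "prank z \<le> prank l" using ord[of p] by (auto simp: lab_less_def)
  qed
  have cox: "cox_eq (map fst L @ [x]) (reading_word P0 @ [x])"
    using rec(5) by (intro cox_eq_append) auto
  then have red: "red n (reading_word P0 @ [x])"
    using L red_cox_eq by (auto simp: labelled_word_def)
  then obtain P a where P: "ins x P0 P a"
    using ins_exists[OF red] rec(2) by (auto simp: tableau_def)
  have shape: "map length P = map length (add_cell a l Q0)" "a \<le> length Q0"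
    using ins_shape[OF P] shape_add_cell[OF rec(4), of a l x] lenQ by auto
  have tab: "tableau P" using ins_tableau[OF P rec(2)] .
  \<comment> \<open>A new label meets no constraint. Otherwise, labels being weakly increasing, the
    preceding letter carries \<open>l\<close> too and filled the last box of \<open>Q0\<close>, in
    row \<open>b\<close>. The new row is strictly below \<open>b\<close> after a descent (primed)
    and weakly above it after an ascent.\<close>
  have "addable Q0 l a"
  proof (cases "l \<in> snd ` set L")
    case False
    then have "\<forall>r \<in> set Q0. l \<notin> set r" using labels by auto
    then show ?thesis using shape(2) by (auto simp: addable_def dest: in_set_dropD in_set_takeD)
  next
    case True
    then obtain L' y m where L': "L = L' @ [(y, m)]" by (metis empty_iff image_is_empty list.set(1) rev_exhaust surj_pair)
    have "prank l \<le> prank m"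
      using True L L' by (auto simp: labelled_word_def sorted_wrt_append lab_less_def)
    then have m: "m = l" and xy: "if is_primed l then x < y else y < x"
      using ord[of "(y, m)"] L' by (auto simp: lab_less_def)
    obtain P1 b where b: "ins y P1 P0 b" "last_box Q0 l b"
      using rec(7) L' m by auto
    show ?thesis
    proof (cases "is_primed l")
      case True
      then have "Suc b \<le> a" using ins_ins_greater[OF b(1) P] xy by simp
      then show ?thesis
        using b(2) shape(2) True set_drop_subset_set_drop[of "Suc b" a Q0]
        by (auto simp: addable_def last_box_def)
    next
      case False
      then have "a \<le> b" using ins_ins_less[OF b(1) P] xy by simp
      then show ?thesis
        using b(2) shape(2) False set_take_subset_set_take[of a b Q0]
        by (auto simp: addable_def last_box_def)
    qed
  qed
  moreover have ys: "young_shape (add_cell a l Q0)"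
    using young_shape_cong[OF shape(1)[symmetric]] tableau_young_shape[OF tab] by simp
  ultimately have Q: "qtab k (add_cell a l Q0)" "last_box (add_cell a l Q0) l a"
    using qtab_add_cell[OF rec(3) ys _ al le] by auto
  have "0 \<notin> set (reading_word P0)" "0 < x"
    using red_pos[OF red] by auto
  then have "cox_eq (map fst L @ [x]) (reading_word P)"
    using cox_eq_trans[OF cox ins_cox_eq[OF P]] by simp
  then have "recorded k (L @ [(x, l)]) P (add_cell a l Q0)"
    using record_ins_snoc[OF rec(1) P] tab Q shape(1) rec(6) P
    by (auto simp: recorded_def count_list_add_cell simp del: count_list_concat)
  then show ?thesis using P Q(2) \<open>addable Q0 l a\<close> by blast
qed

lemma recorded_exists:
  assumes "labelled_word n k L"
  shows "\<exists>P Q. recorded k L P Q"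
  using assms
proof (induction L rule: rev_induct)
  case Nil
  have "recorded k [] [] []" by (simp add: recorded_def qtab_def)
  then show ?case by blast
next
  case (snoc p L)
  then obtain P0 Q0 where "recorded k L P0 Q0" using labelled_word_butlast by blast
  then show ?case using recorded_step[of n k L "fst p" "snd p"] snoc.prems
    by (metis prod.collapse)
qed

lemma record_ins_recorded:
  assumes "labelled_word n k L" "record_ins L = (P, Q)"
  shows "recorded k L P Q"
  using recorded_exists[OF assms(1)] assms(2) by (auto simp: recorded_def)

lemma recorded_length:
  assumes "recorded k L P Q"
  shows "length L = length (reading_word P)"
  using assms by (auto simp: recorded_def cox_eq_def)

text \<open>\<open>last_box_unique\<close> recovers label and row of the final letter from
  \<open>Q\<close>; given the row, \<open>ins_inj\<close> and \<open>add_cell_inj\<close> undo the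
  step in both tableaux.\<close>

lemma record_ins_inj:
  assumes "labelled_word n k L" "labelled_word n k M" "record_ins L = record_ins M"
  shows "L = M"
  using assms
proof (induction L arbitrary: M rule: rev_induct)
  case Nil
  have "recorded k M [] []" using record_ins_recorded Nil(2,3) by simp
  then show ?case using recorded_length by fastforce
next
  case (snoc p L)
  obtain P Q where "record_ins M = (P, Q)" by fastforce
  then have PQ: "recorded k (L @ [p]) P Q" "recorded k M P Q"
    using record_ins_recorded[OF snoc(2)] record_ins_recorded[OF snoc(3)] snoc(4) by auto
  then have "length M = Suc (length L)"
    using recorded_length[OF PQ(1)] recorded_length[OF PQ(2)] by simp
  then obtain M' q where M: "M = M' @ [q]" by (cases M rule: rev_cases) auto
  obtain x l y m where pq: "p = (x, l)" "q = (y, m)" by (cases p; cases q)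
  note LM = snoc.prems(1)[unfolded pq] snoc.prems(2)[unfolded M pq]
  obtain P0 Q0 where L0: "recorded k L P0 Q0"
    using recorded_exists labelled_word_butlast[OF LM(1)] by blast
  obtain P1 Q1 where M0: "recorded k M' P1 Q1"
    using recorded_exists labelled_word_butlast[OF LM(2)] by blast
  obtain a where a: "ins x P0 P a" "addable Q0 l a" "Q = add_cell a l Q0" "last_box Q l a"
    using recorded_step[OF LM(1) L0] PQ(1) pq by (auto simp: recorded_def)
  obtain b where b: "ins y P1 P b" "addable Q1 m b" "Q = add_cell b m Q1" "last_box Q m b"
    using recorded_step[OF LM(2) M0] PQ(2) pq M by (auto simp: recorded_def)
  have "l = m" "a = b"
    using last_box_unique[OF a(4) b(4)] PQ(1) by (auto simp: recorded_def)
  moreover have "x = y" "P0 = P1" using ins_inj[OF a(1)] b(1) \<open>a = b\<close> by auto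
  moreover have "Q0 = Q1"
    using add_cell_inj[of a l Q0 Q1] a b \<open>l = m\<close> \<open>a = b\<close> L0 M0
    by (auto simp: addable_def recorded_def qtab_def)
  ultimately have "L = M'"
    using snoc.IH[of M'] labelled_word_butlast[OF LM(1)] labelled_word_butlast[OF LM(2)] L0 M0
    by (auto simp: recorded_def)
  then show ?case using M pq \<open>l = m\<close> \<open>x = y\<close> by simp
qed

lemma record_ins_surj:
  assumes "tableau P" "qtab k Q" "red n (reading_word P)" "map length Q = map length P"
  shows "\<exists>L. labelled_word n k L \<and> record_ins L = (P, Q)"
  using assms
proof (induction "length (reading_word P)" arbitrary: P Q)
  case 0
  then have "P = []" by (cases P) (auto simp: tableau_Cons)
  then have "labelled_word n k [] \<and> record_ins [] = (P, Q)"
    using 0 by (auto simp: labelled_word_def)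
  then show ?case by blast
next
  case (Suc N)
  have lenQ: "length Q = length P" using Suc.prems(4) by (metis length_map)
  have len: "length (Q ! i) = length (P ! i)" if "i < length P" for i
    using Suc.prems(4) that lenQ by (metis nth_map)
  have "Q \<noteq> []" using Suc.hyps(2) lenQ by auto
  then obtain l a Q0 where Q: "Q = add_cell a l Q0" "qtab k Q0" "addable Q0 l a" "in_alphabet k l"
    "a < length Q" "Suc a < length Q \<longrightarrow> length (Q ! Suc a) < length (Q ! a)"
    "\<forall>r \<in> set Q0. \<forall>z \<in> set r. prank z \<le> prank l"
    using qtab_remove[OF Suc.prems(2)] by metis
  obtain x P0 where P: "ins x P0 P a" "tableau P0"
    using ins_reverse_exists[OF Suc.prems(1,3), of a] Q(5,6) lenQ len by auto
  have pos: "0 < x" "0 \<notin> set (reading_word P0)"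
    using ins_set[OF P(1)] red_posD[OF Suc.prems(3)] by auto
  have cox: "cox_eq (reading_word P0 @ [x]) (reading_word P)"
    using ins_cox_eq[OF P(1)] pos by simp
  then have red: "red n (reading_word P0 @ [x])" using Suc.prems(3) red_cox_eq by blast
  have "map length Q0 = map length P0"
    using shape_add_cell_inj[of a l Q0 x P0] Suc.prems(4) ins_shape[OF P(1)] Q(1,2,3) P(2)
    by (auto simp: addable_def qtab_def tableau_def)
  moreover have "N = length (reading_word P0)"
    using cox Suc.hyps(2) by (auto simp: cox_eq_def)
  ultimately obtain L where L: "labelled_word n k L" "record_ins L = (P0, Q0)"
    using Suc.hyps(1) P(2) Q(2) red_prefix[OF red] by blast
  then have rec: "recorded k L P0 Q0"
    by (rule record_ins_recorded)
  have "cox_eq (map fst L @ [x]) (reading_word P0 @ [x])"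
    using rec by (intro cox_eq_append) (auto simp: recorded_def)
  then have redL: "red n (map fst L @ [x])" using red red_cox_eq by blast
  \<comment> \<open>Were two letters with the same label in the wrong order, comparing the
    insertions would put row \<open>b\<close>, which holds \<open>l\<close>, among the rows that
    \<open>addable\<close> keeps free of \<open>l\<close>. Equal letters contradict
    reducedness.\<close>
  have "lab_less (last L) (x, l)" if "L \<noteq> []"
  proof -
    obtain L' y m where L': "L = L' @ [(y, m)]" using \<open>L \<noteq> []\<close> by (metis rev_exhaust surj_pair)
    obtain P1 b where b: "ins y P1 P0 b" "last_box Q0 m b"
      using rec L' by (auto simp: recorded_def)
    then have b': "b < length Q0" "m \<in> set (Q0 ! b)" by (auto simp: last_box_def)
    have "prank m \<le> prank l" using Q(7) b' by auto
    moreover have "in_alphabet k m" using Q(2) b' unfolding qtab_def by (meson nth_mem)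
    then have "m = l" if "\<not> prank m < prank l"
      using that \<open>prank m \<le> prank l\<close> prank_inj[of k m l] Q(4) by simp
    moreover have "x \<noteq> y"
      using redL red_no_square[of n "map fst L'" x "[]"] L' by auto
    moreover have "x < y" if "m = l" "is_primed l"
    proof (rule ccontr)
      assume "\<not> x < y"
      then have "a \<le> b" using ins_ins_less[OF b(1) P(1)] \<open>x \<noteq> y\<close> by simp
      then have "Q0 ! b \<in> set (drop a Q0)"
        using b'(1) nth_mem[of "b - a" "drop a Q0"] by simp
      then show False using Q(3) b' that by (auto simp: addable_def)
    qed
    moreover have "y < x" if "m = l" "\<not> is_primed l"
    proof (rule ccontr)
      assume "\<not> y < x"
      then have "b < a" using ins_ins_greater[OF b(1) P(1)] \<open>x \<noteq> y\<close> by simp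
      then have "Q0 ! b \<in> set (take a Q0)"
        using b'(1) nth_mem[of b "take a Q0"] by simp
      then show False using Q(3) b' that by (auto simp: addable_def)
    qed
    ultimately show ?thesis using L' by (auto simp: lab_less_def)
  qed
  then have "labelled_word n k (L @ [(x, l)])"
    using L(1) Q(4) redL sorted_wrt_snoc[OF transp_lab_less] by (auto simp: labelled_word_def)
  then show ?case
    using record_ins_snoc[OF L(2) P(1)] Q(1) by metis
qed

section \<open>Factorizations as labelled words\<close>

definition letter_label :: "nat \<Rightarrow> int \<Rightarrow> nat \<times> primed" where
  "letter_label l a = (nat \<bar>a\<bar>, if a < 0 then Primed l else Unprimed l)"

lemma labelled_letters_Nil [simp]: "labelled_letters [] = []"
  by (simp add: labelled_letters_def)

lemma labelled_letters_snoc [simp]: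
  "labelled_letters (v @ [b]) = labelled_letters v @ map (letter_label (Suc (length v))) b"
proof -
  have "[1..<length (v @ [b]) + 1] = [1..<length v + 1] @ [Suc (length v)]" by simp
  then show ?thesis
    unfolding labelled_letters_def by (simp add: letter_label_def[abs_def] del: upt_Suc)
qed

lemma map_fst_labelled_letters: "map fst (labelled_letters v) = map (nat \<circ> abs) (concat v)"
  by (induction v rule: rev_induct) (simp_all add: letter_label_def)

lemma labelled_letters_alphabet:
  "p \<in> set (labelled_letters v) \<Longrightarrow> in_alphabet (length v) (snd p)"
proof (induction v rule: rev_induct)
  case (snoc b v)
  have "in_alphabet (Suc k) q" if "in_alphabet k q" for k q
    using that by (cases q) auto
  then show ?case using snoc by (auto simp: letter_label_def)
qed simp

lemma in_alphabet_prank: "in_alphabet k q \<Longrightarrow> prank q \<le> 2 * k"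
  by (cases q) auto

text \<open>\<open>Suc l\<close> matters: only at a positive index does \<open>Primed\<close> rank
  strictly below \<open>Unprimed\<close>.\<close>

lemma letter_label_less:
  "x < y \<Longrightarrow> x \<noteq> 0 \<Longrightarrow> lab_less (letter_label (Suc l) x) (letter_label (Suc l) y)"
  by (cases "x < 0"; cases "y < 0") (simp_all add: lab_less_def letter_label_def)

lemma sorted_labelled_letters:
  assumes "\<forall>b \<in> set v. sorted_wrt (<) b" "0 \<notin> set (concat v)"
  shows "sorted_wrt lab_less (labelled_letters v)"
  using assms
proof (induction v rule: rev_induct)
  case (snoc b v)
  have "sorted_wrt (\<lambda>x y. lab_less (letter_label (Suc (length v)) x) (letter_label (Suc (length v)) y)) b"
  proof (rule sorted_wrt_mono_rel)
    show "sorted_wrt (<) b" using snoc.prems by simp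
    fix x y assume "x \<in> set b" "x < y"
    then show "lab_less (letter_label (Suc (length v)) x) (letter_label (Suc (length v)) y)"
      using snoc.prems by (intro letter_label_less) auto
  qed
  \<comment> \<open>Earlier labels have rank at most \<open>2 * length v\<close>, those of the new
    block at least one more.\<close>
  moreover have "lab_less p (letter_label (Suc (length v)) a)"
    if "p \<in> set (labelled_letters v)" for p a
    using in_alphabet_prank[OF labelled_letters_alphabet[OF that]]
    by (auto simp: lab_less_def letter_label_def)
  ultimately show ?case
    using snoc by (auto simp: sorted_wrt_append sorted_wrt_map)
qed simp

text \<open>The labels show which letters form the last block and what their signs are; the common
  number of blocks accounts for empty ones.\<close>

lemma labelled_letters_inj:
  assumes "labelled_letters v = labelled_letters w" "length v = length w"
  shows "v = w"
  using assms
proof (induction v arbitrary: w rule: rev_induct)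
  case (snoc b v)
  then obtain w' c where w: "w = w' @ [c]" by (cases w rule: rev_cases) auto
  let ?k = "length v" and ?P = "\<lambda>p. in_alphabet (length v) (snd p)"
  have len: "length w' = ?k" using snoc.prems(2) w by simp
  have eq: "labelled_letters v @ map (letter_label (Suc ?k)) b =
      labelled_letters w' @ map (letter_label (Suc ?k)) c"
    using snoc.prems(1) w len by simp
  have "filter ?P (map (letter_label (Suc ?k)) d) = []" for d
    by (auto simp: filter_empty_conv letter_label_def)
  moreover have "filter ?P (labelled_letters u) = labelled_letters u" if "length u = ?k" for u
    using labelled_letters_alphabet[of _ u] that by (simp add: filter_id_conv)
  ultimately have lv: "labelled_letters v = labelled_letters w'"
    using arg_cong[OF eq, of "filter ?P"] len by (simp only: filter_append append_Nil2)
  then have "map (letter_label (Suc ?k)) b = map (letter_label (Suc ?k)) c"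
    using eq by simp
  moreover have "inj (letter_label (Suc ?k))"
    by (auto simp: inj_def letter_label_def split: if_splits)
  ultimately show ?case
    using snoc.IH[OF lv] len w by (simp add: inj_map_eq_map)
qed simp

definition unlabel :: "nat \<times> primed \<Rightarrow> int" where
  "unlabel p = (if is_primed (snd p) then - int (fst p) else int (fst p))"

text \<open>Labels never decrease along \<open>L\<close>, so those beyond \<open>k\<close> occupy a
  final segment, possibly empty, which becomes the last block.\<close>

lemma labelled_letters_surj:
  assumes "sorted_wrt lab_less L" "\<forall>p \<in> set L. in_alphabet k (snd p) \<and> 0 < fst p"
  shows "\<exists>v. length v = k \<and> 0 \<notin> set (concat v) \<and> (\<forall>b \<in> set v. sorted_wrt (<) b) \<and>
    labelled_letters v = L"
  using assms
proof (induction k arbitrary: L)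
  case 0
  have "L = []"
  proof (cases L)
    case (Cons p L')
    then show ?thesis using 0 by (cases "snd p") auto
  qed simp
  then show ?case by auto
next
  case (Suc k)
  let ?P = "\<lambda>p. in_alphabet k (snd p)"
  define L1 L2 where "L1 = takeWhile ?P L" and "L2 = dropWhile ?P L"
  have L: "L = L1 @ L2" by (simp add: L1_def L2_def)
  have "\<forall>p \<in> set L1. in_alphabet k (snd p) \<and> 0 < fst p"
    using Suc.prems(2) by (auto simp: L1_def dest: set_takeWhileD)
  then obtain v where v: "length v = k" "0 \<notin> set (concat v)" "\<forall>b \<in> set v. sorted_wrt (<) b"
    "labelled_letters v = L1"
    using Suc.IH[of L1] Suc.prems(1) L by (auto simp: sorted_wrt_append)
  have last: "snd p = Primed (Suc k) \<or> snd p = Unprimed (Suc k)" if p: "p \<in> set L2" for p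
  proof -
    obtain q L3 where L2: "L2 = q # L3" using p by (cases L2) auto
    then have "\<not> in_alphabet k (snd q)" unfolding L2_def
      by (metis hd_dropWhile list.distinct(1) list.sel(1))
    moreover have "in_alphabet (Suc k) (snd r)" if "r \<in> set L2" for r
      using that Suc.prems(2) L by auto
    \<comment> \<open>The first letter of \<open>L2\<close> has left the alphabet of
      \<open>k\<close>, so its label is one of the two with index \<open>Suc k\<close>; sortedness
      passes the bound on to the later letters.\<close>
    ultimately have "2 * k < prank (snd q)"
      using L2 by (cases "snd q") (fastforce simp: not_le)+
    moreover have "p = q \<or> lab_less q p"
      using p L2 Suc.prems(1) L by (auto simp: sorted_wrt_append)
    ultimately have "2 * k < prank (snd p)" by (auto simp: lab_less_def)
    moreover have "in_alphabet (Suc k) (snd p)" using p Suc.prems(2) L by auto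
    ultimately show ?thesis by (cases "snd p") auto
  qed
  have pos: "0 < fst p" if "p \<in> set L2" for p
    using that Suc.prems(2) L by auto
  have "letter_label (Suc k) (unlabel p) = p" if "p \<in> set L2" for p
    using last[OF that] pos[OF that] by (cases p) (auto simp: letter_label_def unlabel_def)
  then have "map (letter_label (Suc k)) (map unlabel L2) = L2"
    by (simp add: map_idI)
  moreover have "sorted_wrt (<) (map unlabel L2)"
  proof -
    have "unlabel p < unlabel q" if "p \<in> set L2" "q \<in> set L2" "lab_less p q" for p q
      using last[OF that(1)] last[OF that(2)] pos[OF that(1)] pos[OF that(2)] that(3)
      by (auto simp: lab_less_def unlabel_def)
    then show ?thesis
      using Suc.prems(1) L sorted_wrt_mono_rel[of L2 lab_less "\<lambda>p q. unlabel p < unlabel q"]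
      by (auto simp: sorted_wrt_append sorted_wrt_map)
  qed
  moreover have "0 \<notin> set (map unlabel L2)"
    using pos by (fastforce simp: unlabel_def)
  ultimately show ?case
    using v L by (intro exI[of _ "v @ [map unlabel L2]"]) auto
qed

section \<open>Double weights\<close>

lemma count_letter_label:
  "count_list (map snd (map (letter_label l) b)) (Primed i) =
     (if i = l then length (filter (\<lambda>a. a < 0) b) else 0)"
  "count_list (map snd (map (letter_label l) b)) (Unprimed i) =
     (if i = l then length (filter (\<lambda>a. 0 \<le> a) b) else 0)"
  by (induction b) (auto simp: letter_label_def)

lemma count_labelled_letters_outside:
  assumes "\<not> in_alphabet (length v) z"
  shows "count_list (map snd (labelled_letters v)) z = 0"
  using assms labelled_letters_alphabet[of _ v] by (auto simp: count_list_0_iff)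

lemma dw_fact_labelled_letters:
  "dw_fact v =
     (map (\<lambda>i. count_list (map snd (labelled_letters v)) (Primed i)) [1..<length v + 1],
      map (\<lambda>i. count_list (map snd (labelled_letters v)) (Unprimed i)) [1..<length v + 1])"
proof (induction v rule: rev_induct)
  case (snoc b v)
  have "count_list (map snd (labelled_letters v)) (Primed (Suc (length v))) = 0"
    "count_list (map snd (labelled_letters v)) (Unprimed (Suc (length v))) = 0"
    by (rule count_labelled_letters_outside, simp)+
  then show ?case
    using snoc unfolding dw_fact_def
    by (auto simp del: map_map simp: count_letter_label)
qed (simp add: dw_fact_def)

section \<open>Assembling the bijection\<close>

lemma PREG_record_ins: "PREG v = record_ins (labelled_letters v)"
  by (simp add: PREG_def record_ins_def)

lemma word_eval_nat_abs: "word_eval (map int (map (nat \<circ> abs) u)) = word_eval u"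
proof -
  have "map int (map (nat \<circ> abs) u) = map abs u" by simp
  then show ?thesis using word_eval_abs by metis
qed

text \<open>Signs affect neither value nor length, and \<open>reduced_word_nonzero\<close> excludes
  the letter 0, so passing to absolute values loses nothing about reducedness.\<close>

lemma reduced_word_red:
  assumes "\<omega> \<in> A_grp n"
  shows "reduced_word n \<omega> u \<longleftrightarrow>
    0 \<notin> set u \<and> red n (map (nat \<circ> abs) u) \<and> word_eval u = \<omega>"
proof -
  have "u \<in> gen_words n \<longleftrightarrow> set (map (nat \<circ> abs) u) \<subseteq> {1..n}" if "0 \<notin> set u"
  proof -
    have "- int n \<le> a \<and> a \<le> int n \<longleftrightarrow> 1 \<le> nat \<bar>a\<bar> \<and> nat \<bar>a\<bar> \<le> n" if "a \<in> set u" for a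
      using that \<open>0 \<notin> set u\<close> by (cases "a = 0") auto
    then show ?thesis by (auto simp: gen_words_def image_subset_iff)
  qed
  then show ?thesis
    using reduced_word_nonzero[OF _ assms] word_eval_nat_abs[of u]
    unfolding reduced_word_iff red_def by auto
qed

lemma EG_tableau_iff:
  assumes "\<omega> \<in> A_grp n"
  shows "EG_tableau n \<omega> P \<longleftrightarrow>
    tableau P \<and> red n (reading_word P) \<and> word_eval (map int (reading_word P)) = \<omega>"
proof -
  have "map (nat \<circ> abs) (map int (reading_word P)) = reading_word P"
    by (simp add: map_idI)
  then have "reduced_word n \<omega> (map int (reading_word P)) \<longleftrightarrow>
      red n (reading_word P) \<and> word_eval (map int (reading_word P)) = \<omega>"
    using reduced_word_red[OF assms, of "map int (reading_word P)"] red_pos[of n "reading_word P"]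
    by auto
  moreover have "\<forall>r \<in> set P. \<forall>x \<in> set r. 1 \<le> x \<and> x \<le> n" if "red n (reading_word P)"
    using that by (auto simp: red_def reading_word_def)
  ultimately show ?thesis
    using columns_iff[of P "(<)"] by (auto simp: EG_tableau_def tableau_def)
qed

lemma RSIF_iff:
  assumes "\<omega> \<in> A_grp n"
  shows "v \<in> RSIF n k \<omega> \<longleftrightarrow> length v = k \<and> 0 \<notin> set (concat v) \<and>
    (\<forall>b \<in> set v. sorted_wrt (<) b) \<and> labelled_word n k (labelled_letters v) \<and>
    word_eval (map int (map fst (labelled_letters v))) = \<omega>"
  using sorted_labelled_letters[of v] labelled_letters_alphabet[of _ v]
  unfolding RSIF_def reduced_word_red[OF assms] labelled_word_def map_fst_labelled_letters
    word_eval_nat_abs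
  by blast

theorem theorem2p1:
  fixes n k :: nat and \<omega> :: "int \<Rightarrow> int"
  assumes "n \<ge> 1" and "k \<ge> 1" and "\<omega> \<in> A_grp n"
  shows "bij_betw PREG (RSIF n k \<omega>)
           {(P, Q). EG_tableau n \<omega> P \<and> primed_tableau k Q \<and> map length Q = map length P}
         \<and> (\<forall>v \<in> RSIF n k \<omega>. dw_fact v = dw_tab k (snd (PREG v)))"
proof (intro conjI ballI bij_betw_imageI)
  note RSIF = RSIF_iff[OF assms(3)] and EG = EG_tableau_iff[OF assms(3)]
  show "inj_on PREG (RSIF n k \<omega>)"
  proof (rule inj_onI)
    fix v w assume "v \<in> RSIF n k \<omega>" "w \<in> RSIF n k \<omega>" "PREG v = PREG w"
    then show "v = w"
      using record_ins_inj[of n k "labelled_letters v" "labelled_letters w"]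
        labelled_letters_inj[of v w] by (simp add: RSIF PREG_record_ins)
  qed
  have rec: "\<exists>P Q. PREG v = (P, Q) \<and> recorded k (labelled_letters v) P Q" if "v \<in> RSIF n k \<omega>" for v
    using recorded_exists[of n k "labelled_letters v"] that
    by (auto simp: RSIF PREG_record_ins recorded_def)
  show "PREG ` RSIF n k \<omega> =
    {(P, Q). EG_tableau n \<omega> P \<and> primed_tableau k Q \<and> map length Q = map length P}"
  proof (intro equalityI subsetI)
    fix PQ assume "PQ \<in> PREG ` RSIF n k \<omega>"
    then obtain v where v: "v \<in> RSIF n k \<omega>" "PQ = PREG v" by blast
    obtain P Q where PQ: "PREG v = (P, Q)" "recorded k (labelled_letters v) P Q"
      using rec[OF v(1)] by blast
    then have cox: "cox_eq (map fst (labelled_letters v)) (reading_word P)"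
      by (simp add: recorded_def)
    then have "red n (reading_word P)" "word_eval (map int (reading_word P)) = \<omega>"
      using v(1) red_cox_eq[OF cox] unfolding RSIF labelled_word_def cox_eq_def by auto
    then show "PQ \<in> {(P, Q). EG_tableau n \<omega> P \<and> primed_tableau k Q \<and> map length Q = map length P}"
      using v(2) PQ by (auto simp: recorded_def EG primed_tableau_iff)
  next
    fix PQ
    assume "PQ \<in> {(P, Q). EG_tableau n \<omega> P \<and> primed_tableau k Q \<and> map length Q = map length P}"
    then obtain P Q where PQ: "PQ = (P, Q)" "tableau P" "red n (reading_word P)"
      "word_eval (map int (reading_word P)) = \<omega>" "qtab k Q" "map length Q = map length P"
      by (auto simp: EG primed_tableau_iff)
    obtain L where L: "labelled_word n k L" "record_ins L = (P, Q)"
      using record_ins_surj PQ by blast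
    \<comment> \<open>With positive letters the prime can be turned back into a sign.\<close>
    have "\<forall>p \<in> set L. in_alphabet k (snd p) \<and> 0 < fst p"
      using L(1) red_posD[of n "map fst L"] by (auto simp: labelled_word_def)
    then obtain v where v: "length v = k" "0 \<notin> set (concat v)" "\<forall>b \<in> set v. sorted_wrt (<) b"
      "labelled_letters v = L"
      using labelled_letters_surj[of L k] L(1) unfolding labelled_word_def by blast
    \<comment> \<open>Carries the value \<omega> from the reading word of \<open>P\<close> back to
      \<open>v\<close>.\<close>
    have "cox_eq (map fst L) (reading_word P)"
      using record_ins_recorded[OF L] by (simp add: recorded_def)
    then have "v \<in> RSIF n k \<omega>"
      using v L(1) PQ(4) by (simp add: RSIF cox_eq_def)
    moreover have "PREG v = PQ"
      using v(4) L(2) PQ(1) by (simp add: PREG_record_ins)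
    ultimately show "PQ \<in> PREG ` RSIF n k \<omega>" by blast
  qed
  fix v assume v: "v \<in> RSIF n k \<omega>"
  then have "length v = k" by (simp add: RSIF)
  then show "dw_fact v = dw_tab k (snd (PREG v))"
    using rec[OF v] dw_fact_labelled_letters[of v] by (auto simp: dw_tab_def recorded_def)
qed

end
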